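(* Let $n\ge 1$ be a positive integer. Every non-unitary contraction in $\mathfrak{L}_n$ has an $H^\infty$ functional calculus.
   Context: Let $\mathcal{F}_n$ be the unital free semigroup on $n$ generators $z_1,\dots,z_n$ (its unit is the empty word $1$), and let $\mathcal{H}_n=\ell_2(\mathcal{F}_n)$, with orthonormal basis $\{\xi_w: w\in\mathcal{F}_n\}$. Let $L_i$ be the isometry on $\mathcal{H}_n$ with $L_i\xi_v=\xi_{z_iv}$. The non-commutative analytic Toeplitz algebra $\mathfrak{L}_n$ is the unital algebra, closed in the weak operator topology, generated by $L_1,\dots,L_n$ in $\mathcal{B}(\mathcal{H}_n)$. $H^\infty$ is the algebra of bounded analytic functions on the open unit disk. A contraction $T\in\mathcal{B}(\mathcal{H})$ has an $H^\infty$ functional calculus (in the sense of Sz.-Nagy and Foias) if for every $u(z)=\sum_{k\ge0}c_kz^k\in H^\infty$ the limit $u(T)=\lim_{r\to1^-}\sum_{k\ge 0}r^kc_kT^k$ exists in the strong operator topology, and $u\mapsto u(T)$ is a unital algebra homomorphism $H^\infty\to\mathcal{B}(\mathcal{H})$ that sends the function $z$ to $T$, satisfies $\|u(T)\|\le\|u\|_\infty$, and sends sequences converging weak* in $H^\infty$ to sequences converging in the weak operator topology. *)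

theory Defs
  imports "HOL-Analysis.Analysis"
begin

section \<open>The complex Hilbert space of square-summable families\<close>

typedef 'a ell2 = "{f :: 'a \<Rightarrow> complex. (\<lambda>x. (cmod (f x))\<^sup>2) summable_on UNIV}"
  morphisms coord Abs_ell2
  by (rule exI[of _ "\<lambda>_. 0"]) simp

setup_lifting type_definition_ell2

lemma coord_summable: "(\<lambda>x. (cmod (coord f x))\<^sup>2) summable_on UNIV"
  using coord[of f] by simp

lemma ell2_eqI: "(\<And>x. coord f x = coord g x) \<Longrightarrow> f = g"
  by (simp add: coord_inject[symmetric] fun_eq_iff)

lemma square_summable_add:
  assumes "(\<lambda>x. (cmod (f x))\<^sup>2) summable_on UNIV" "(\<lambda>x. (cmod (g x))\<^sup>2) summable_on UNIV"
  shows "(\<lambda>x. (cmod (f x + g x))\<^sup>2) summable_on UNIV"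
proof (rule summable_on_comparison_test)
  show "(\<lambda>x. 2 * (cmod (f x))\<^sup>2 + 2 * (cmod (g x))\<^sup>2) summable_on UNIV"
    by (intro summable_on_add summable_on_cmult_right assms)
  fix x
  have "(cmod (f x + g x))\<^sup>2 \<le> (cmod (f x) + cmod (g x))\<^sup>2"
    by (intro power_mono norm_triangle_ineq) auto
  also have "\<dots> \<le> 2 * (cmod (f x))\<^sup>2 + 2 * (cmod (g x))\<^sup>2"
    using sum_squares_bound[of "cmod (f x)" "cmod (g x)"] by (simp add: power2_sum)
  finally show "(cmod (f x + g x))\<^sup>2 \<le> 2 * (cmod (f x))\<^sup>2 + 2 * (cmod (g x))\<^sup>2" .
qed auto

lemma square_summable_cmult:
  assumes "(\<lambda>x. (cmod (f x))\<^sup>2) summable_on UNIV"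
  shows "(\<lambda>x. (cmod (c * f x))\<^sup>2) summable_on UNIV"
  using summable_on_cmult_right[OF assms, of "(cmod c)\<^sup>2"]
  by (simp add: norm_mult power_mult_distrib)

lift_definition cscale :: "complex \<Rightarrow> 'a ell2 \<Rightarrow> 'a ell2" is "\<lambda>c f x. c * f x"
  by (rule square_summable_cmult)

definition cinner :: "'a ell2 \<Rightarrow> 'a ell2 \<Rightarrow> complex" where
  "cinner f g = (\<Sum>\<^sub>\<infinity>x. coord f x * cnj (coord g x))"

instantiation ell2 :: (type) real_inner
begin

lift_definition zero_ell2 :: "'a ell2" is "\<lambda>_. 0" by simp

lift_definition plus_ell2 :: "'a ell2 \<Rightarrow> 'a ell2 \<Rightarrow> 'a ell2" is "\<lambda>f g x. f x + g x"
  by (rule square_summable_add)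

lift_definition uminus_ell2 :: "'a ell2 \<Rightarrow> 'a ell2" is "\<lambda>f x. - f x" by simp

definition "f - g = f + - g" for f g :: "'a ell2"
definition "scaleR r f = cscale (of_real r) f" for f :: "'a ell2"
definition "norm f = sqrt (\<Sum>\<^sub>\<infinity>x. (cmod (coord f x))\<^sup>2)" for f :: "'a ell2"
definition "dist f g = norm (f - g)" for f g :: "'a ell2"
definition "sgn f = cscale (of_real (inverse (norm f))) f" for f :: "'a ell2"
definition "uniformity = (INF e\<in>{0<..}. principal {(f :: 'a ell2, g). dist f g < e})"
definition "open U = (\<forall>f\<in>U. \<forall>\<^sub>F (f', g) in uniformity. f' = f \<longrightarrow> g \<in> U)" for U :: "'a ell2 set"
definition "inner f g = Re (cinner f g)" for f g :: "'a ell2"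

lemma coord_product_summable: "(\<lambda>x. coord f x * cnj (coord g x)) summable_on UNIV"
proof -
  have "(\<lambda>x. norm (coord f x * cnj (coord g x))) summable_on UNIV"
    by (rule abs_summable_product)
      (use coord_summable[of f] coord_summable[of g] in
        \<open>auto simp: norm_mult power2_eq_square\<close>)
  then show ?thesis by (simp add: summable_on_iff_abs_summable_on_complex)
qed

lemma cinner_self: "cinner f f = of_real (\<Sum>\<^sub>\<infinity>x. (cmod (coord f x))\<^sup>2)"
proof -
  have "cinner f f = (\<Sum>\<^sub>\<infinity>x. of_real ((cmod (coord f x))\<^sup>2))"
    unfolding cinner_def by (intro infsum_cong) (simp add: complex_mult_cnj cmod_power2)
  also have "\<dots> = of_real (\<Sum>\<^sub>\<infinity>x. (cmod (coord f x))\<^sup>2)"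
    by (intro infsumI has_sum_of_real has_sum_infsum coord_summable)
  finally show ?thesis .
qed

instance
proof
  fix f g h :: "'a ell2" and a b r :: real
  show "f + g + h = f + (g + h)" by transfer (simp add: add.assoc)
  show "f + g = g + f" by transfer (simp add: add.commute)
  show "0 + f = f" by transfer simp
  show "- f + f = 0" by transfer simp
  show "f - g = f + - g" by (rule minus_ell2_def)
  show "a *\<^sub>R (f + g) = a *\<^sub>R f + a *\<^sub>R g"
    unfolding scaleR_ell2_def by transfer (simp add: algebra_simps)
  show "(a + b) *\<^sub>R f = a *\<^sub>R f + b *\<^sub>R f"
    unfolding scaleR_ell2_def by transfer (simp add: algebra_simps)
  show "a *\<^sub>R b *\<^sub>R f = (a * b) *\<^sub>R f"
    unfolding scaleR_ell2_def by transfer (simp add: algebra_simps)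
  show "1 *\<^sub>R f = f" unfolding scaleR_ell2_def by transfer simp
  show "dist f g = norm (f - g)" by (rule dist_ell2_def)
  show "sgn f = inverse (norm f) *\<^sub>R f" by (simp add: sgn_ell2_def scaleR_ell2_def)
  show "uniformity = (INF e\<in>{0<..}. principal {(f :: 'a ell2, g). dist f g < e})"
    by (rule uniformity_ell2_def)
  show "open U = (\<forall>f\<in>U. \<forall>\<^sub>F (f', g) in uniformity. f' = f \<longrightarrow> g \<in> U)" for U :: "'a ell2 set"
    by (rule open_ell2_def)
  show "inner f g = inner g f"
  proof -
    have "cinner f g = cnj (cinner g f)"
      unfolding cinner_def infsum_cnj[symmetric] by (simp add: mult.commute)
    then show ?thesis by (simp add: inner_ell2_def)
  qed
  show "inner (f + g) h = inner f h + inner g h"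
  proof -
    have "cinner (f + g) h = cinner f h + cinner g h"
      unfolding cinner_def plus_ell2.rep_eq
      by (simp add: distrib_right infsum_add coord_product_summable)
    then show ?thesis by (simp add: inner_ell2_def)
  qed
  show "inner (r *\<^sub>R f) g = r * inner f g"
  proof -
    have "cinner (r *\<^sub>R f) g = of_real r * cinner f g"
      unfolding cinner_def scaleR_ell2_def cscale.rep_eq
      by (simp add: mult.assoc infsum_cmult_right')
    then show ?thesis by (simp add: inner_ell2_def)
  qed
  show "0 \<le> inner f f"
    by (simp add: inner_ell2_def cinner_self infsum_nonneg)
  show "inner f f = 0 \<longleftrightarrow> f = 0"
  proof
    assume "inner f f = 0"
    then have 0: "(\<Sum>\<^sub>\<infinity>x. (cmod (coord f x))\<^sup>2) = 0" by (simp add: inner_ell2_def cinner_self)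
    show "f = 0"
    proof (rule ell2_eqI)
      fix x
      have "(cmod (coord f x))\<^sup>2 = 0"
        by (rule nonneg_infsum_le_0D[OF eq_refl[OF 0] coord_summable]) auto
      then show "coord f x = coord 0 x" by (simp add: zero_ell2.rep_eq)
    qed
  qed (simp add: inner_ell2_def cinner_def zero_ell2.rep_eq)
  show "norm f = sqrt (inner f f)"
    by (simp add: inner_ell2_def cinner_self norm_ell2_def)
qed

end

lemma norm_ell2_squared: "(norm f)\<^sup>2 = (\<Sum>\<^sub>\<infinity>x. (cmod (coord f x))\<^sup>2)" for f :: "'a ell2"
  by (simp add: norm_ell2_def infsum_nonneg)

lemma sum_le_norm_ell2:
  assumes "finite F"
  shows "(\<Sum>x\<in>F. (cmod (coord f x))\<^sup>2) \<le> (norm f)\<^sup>2"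
  unfolding norm_ell2_squared
  by (rule finite_sum_le_infsum[OF coord_summable assms]) auto

lemma coord_diff: "coord (f - g) x = coord f x - coord g x"
  unfolding minus_ell2_def plus_ell2.rep_eq uminus_ell2.rep_eq by simp

lemma norm_cscale: "norm (cscale c f) = cmod c * norm f"
  unfolding norm_ell2_def cscale.rep_eq
  by (simp add: norm_mult power_mult_distrib infsum_cmult_right' real_sqrt_mult)

instance ell2 :: (type) complete_space
proof
  fix X :: "nat \<Rightarrow> 'a ell2"
  assume X: "Cauchy X"
  have coord_le: "cmod (coord f x) \<le> norm f" for f :: "'a ell2" and x
    using sum_le_norm_ell2[of "{x}" f] by (simp add: abs_le_square_iff[symmetric])
  have "\<exists>l. (\<lambda>n. coord (X n) x) \<longlonglongrightarrow> l" for x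
  proof -
    have "Cauchy (\<lambda>n. coord (X n) x)"
    proof (rule metric_CauchyI)
      fix e :: real assume "0 < e"
      then obtain M where M: "\<And>m n. m \<ge> M \<Longrightarrow> n \<ge> M \<Longrightarrow> dist (X m) (X n) < e"
        using metric_CauchyD[OF X] by blast
      show "\<exists>M. \<forall>m\<ge>M. \<forall>n\<ge>M. dist (coord (X m) x) (coord (X n) x) < e"
      proof (intro exI allI impI)
        fix m n assume "M \<le> m" "M \<le> n"
        then show "dist (coord (X m) x) (coord (X n) x) < e"
          using M[of m n] coord_le[of "X m - X n" x] by (simp add: dist_norm coord_diff)
      qed
    qed
    then show ?thesis using Cauchy_convergent convergent_def by blast
  qed
  then obtain l where l: "\<And>x. (\<lambda>n. coord (X n) x) \<longlonglongrightarrow> l x" by metis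
  have tail: "\<exists>M. \<forall>m\<ge>M. \<forall>F. finite F \<longrightarrow> (\<Sum>x\<in>F. (cmod (coord (X m) x - l x))\<^sup>2) \<le> e\<^sup>2"
    if "0 < e" for e
  proof -
    obtain M where M: "\<And>m n. m \<ge> M \<Longrightarrow> n \<ge> M \<Longrightarrow> dist (X m) (X n) < e"
      using metric_CauchyD[OF X \<open>0 < e\<close>] by blast
    show ?thesis
    proof (intro exI allI impI)
      fix m and F :: "'a set" assume "M \<le> m" "finite F"
      have "(\<lambda>n. \<Sum>x\<in>F. (cmod (coord (X m) x - coord (X n) x))\<^sup>2)
              \<longlonglongrightarrow> (\<Sum>x\<in>F. (cmod (coord (X m) x - l x))\<^sup>2)"
        by (intro tendsto_intros l)
      moreover have "(\<Sum>x\<in>F. (cmod (coord (X m) x - coord (X n) x))\<^sup>2) \<le> e\<^sup>2" if "n \<ge> M" for n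
      proof -
        have "(\<Sum>x\<in>F. (cmod (coord (X m - X n) x))\<^sup>2) \<le> (norm (X m - X n))\<^sup>2"
          by (rule sum_le_norm_ell2[OF \<open>finite F\<close>])
        also have "\<dots> \<le> e\<^sup>2"
          using M[OF \<open>M \<le> m\<close> that] by (intro power_mono) (auto simp: dist_norm)
        finally show ?thesis by (simp add: coord_diff)
      qed
      ultimately show "(\<Sum>x\<in>F. (cmod (coord (X m) x - l x))\<^sup>2) \<le> e\<^sup>2"
        by (intro LIMSEQ_le_const2) auto
    qed
  qed
  have diff: "(\<lambda>x. (cmod (coord (X m) x - l x))\<^sup>2) summable_on UNIV"
    if "\<forall>F. finite F \<longrightarrow> (\<Sum>x\<in>F. (cmod (coord (X m) x - l x))\<^sup>2) \<le> e\<^sup>2" for m e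
    by (rule nonneg_bdd_above_summable_on) (use that in \<open>auto intro!: bdd_aboveI\<close>)
  obtain m where m: "(\<lambda>x. (cmod (coord (X m) x - l x))\<^sup>2) summable_on UNIV"
    using tail[OF zero_less_one] diff[of _ 1] by blast
  have "(\<lambda>x. (cmod (coord (X m) x + (- 1) * (coord (X m) x - l x)))\<^sup>2) summable_on UNIV"
    by (intro square_summable_add square_summable_cmult coord_summable m)
  then have "(\<lambda>x. (cmod (l x))\<^sup>2) summable_on UNIV" by simp
  then have L: "coord (Abs_ell2 l) = l" by (simp add: Abs_ell2_inverse)
  have "X \<longlonglongrightarrow> Abs_ell2 l"
  proof (rule metric_LIMSEQ_I)
    fix e :: real assume "0 < e"
    then obtain M where M: "\<And>m F. m \<ge> M \<Longrightarrow> finite F \<Longrightarrow>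
        (\<Sum>x\<in>F. (cmod (coord (X m) x - l x))\<^sup>2) \<le> (e / 2)\<^sup>2"
      using tail[of "e / 2"] half_gt_zero by blast
    have "dist (X m) (Abs_ell2 l) < e" if "m \<ge> M" for m
    proof -
      have sq: "(norm (X m - Abs_ell2 l))\<^sup>2 = (\<Sum>\<^sub>\<infinity>x. (cmod (coord (X m) x - l x))\<^sup>2)"
        by (simp only: norm_ell2_squared coord_diff L)
      have "(\<lambda>x. (cmod (coord (X m) x - l x))\<^sup>2) summable_on UNIV"
        using diff[of m "e / 2"] M[OF that] by blast
      then have "(\<Sum>\<^sub>\<infinity>x. (cmod (coord (X m) x - l x))\<^sup>2) \<le> (e / 2)\<^sup>2"
        by (rule infsum_le_finite_sums) (rule M[OF \<open>M \<le> m\<close>])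
      then have "(norm (X m - Abs_ell2 l))\<^sup>2 \<le> (e / 2)\<^sup>2"
        by (simp only: sq)
      then have "norm (X m - Abs_ell2 l) \<le> e / 2"
        by (rule power2_le_imp_le) (use \<open>0 < e\<close> in simp)
      then show ?thesis using \<open>0 < e\<close> by (simp add: dist_norm)
    qed
    then show "\<exists>M. \<forall>m\<ge>M. dist (X m) (Abs_ell2 l) < e" by blast
  qed
  then show "convergent X" by (rule convergentI)
qed

instance ell2 :: (type) banach ..

lift_definition ket :: "'a \<Rightarrow> 'a ell2" is "\<lambda>x y. if y = x then 1 else 0"
proof -
  fix x :: 'a
  have "(\<lambda>y. (cmod (if y = x then 1 else 0))\<^sup>2) summable_on {x}" by simp
  then show "(\<lambda>y. (cmod (if y = x then 1 else 0))\<^sup>2) summable_on UNIV"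
    by (rule summable_on_cong_neutral[THEN iffD1, rotated 3]) auto
qed


section \<open>Bounded operators\<close>

type_synonym 'a op = "'a ell2 \<Rightarrow>\<^sub>L 'a ell2"

text \<open>
  The library type of bounded linear maps is that of the real-linear ones; the operator norm,
  composition and addition are those of the library.
\<close>

definition B_ell2 :: "'a op set" where
  "B_ell2 = {T :: 'a op. \<forall>c f. T (cscale c f) = cscale c (T f)}"

lift_definition scalar_op :: "complex \<Rightarrow> 'a op" is cscale
proof (rule bounded_linear_intro)
  fix c r and f g :: "'a ell2"
  show "cscale c (f + g) = cscale c f + cscale c g" by transfer (simp add: algebra_simps)
  show "cscale c (r *\<^sub>R f) = r *\<^sub>R cscale c f"
    unfolding scaleR_ell2_def by transfer (simp add: algebra_simps)
  show "norm (cscale c f) \<le> norm f * cmod c" by (simp add: norm_cscale)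
qed

definition op_pow :: "'a op \<Rightarrow> nat \<Rightarrow> 'a op" where
  "op_pow T k = ((\<lambda>S. T o\<^sub>L S) ^^ k) id_blinfun"

definition adjoint_of :: "'a op \<Rightarrow> 'a op \<Rightarrow> bool" where
  "adjoint_of T S \<longleftrightarrow> S \<in> B_ell2 \<and> (\<forall>f g. cinner (T f) g = cinner f (S g))"

definition unitary_op :: "'a op \<Rightarrow> bool" where
  "unitary_op T \<longleftrightarrow> T \<in> B_ell2 \<and>
     (\<exists>S. adjoint_of T S \<and> S o\<^sub>L T = id_blinfun \<and> T o\<^sub>L S = id_blinfun)"

text \<open>
  The topology \<open>euclidean\<close> on a function space is the product topology, so this is the coarsest
  topology making all maps \<open>T \<mapsto> \<langle>T f, g\<rangle>\<close> continuous.
\<close>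

definition weak_operator_topology :: "'a op topology" where
  "weak_operator_topology =
     pullback_topology B_ell2 (\<lambda>T (f, g). cinner (T f) g) euclidean"

lemma tendsto_fun_iff:
  fixes P :: "'i \<Rightarrow> 'c \<Rightarrow> 'd::topological_space"
  shows "(P \<longlongrightarrow> l) net \<longleftrightarrow> (\<forall>x. ((\<lambda>i. P i x) \<longlongrightarrow> l x) net)"
  using limitin_componentwise[of "\<lambda>_. euclidean" UNIV P l net]
  by (simp add: euclidean_product_topology)

lemma limitin_pullback_euclidean:
  fixes P :: "'b \<Rightarrow> 'c \<Rightarrow> 'd::topological_space"
  shows "limitin (pullback_topology A P euclidean) F l net \<longleftrightarrow>
     l \<in> A \<and> (\<forall>\<^sub>F i in net. F i \<in> A) \<and> (\<forall>x. ((\<lambda>i. P (F i) x) \<longlongrightarrow> P l x) net)"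
    (is "?L \<longleftrightarrow> ?R")
proof
  assume L: ?L
  then have l: "l \<in> A"
    by (simp add: limitin_def topspace_pullback_topology)
  have op: "openin (pullback_topology A P euclidean) (P -` U \<inter> A)" if "open U" for U
    unfolding openin_pullback_topology using that by auto
  have "\<forall>\<^sub>F i in net. F i \<in> A"
    using L op[of UNIV] l by (auto simp: limitin_def)
  moreover have "((\<lambda>i. P (F i)) \<longlongrightarrow> P l) net"
  proof (rule topological_tendstoI)
    fix U assume "open U" "P l \<in> U"
    then have "\<forall>\<^sub>F i in net. F i \<in> P -` U \<inter> A"
      using L op[of U] l by (auto simp: limitin_def)
    then show "\<forall>\<^sub>F i in net. P (F i) \<in> U" by eventually_elim auto
  qed
  ultimately show ?R
    using l tendsto_fun_iff[of "\<lambda>i. P (F i)"] by blast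
next
  assume R: ?R
  have lim: "((\<lambda>i. P (F i)) \<longlongrightarrow> P l) net"
    using R tendsto_fun_iff[of "\<lambda>i. P (F i)"] by blast
  show ?L
    unfolding limitin_def
  proof (intro conjI allI impI)
    show "l \<in> topspace (pullback_topology A P euclidean)"
      using R by (simp add: topspace_pullback_topology)
    fix V assume "openin (pullback_topology A P euclidean) V \<and> l \<in> V"
    then obtain U where U: "open U" "V = P -` U \<inter> A" "P l \<in> U"
      unfolding openin_pullback_topology by auto
    have "\<forall>\<^sub>F i in net. P (F i) \<in> U" by (rule topological_tendstoD[OF lim U(1,3)])
    with R have "\<forall>\<^sub>F i in net. F i \<in> A \<and> P (F i) \<in> U" by (simp add: eventually_conj)
    then show "\<forall>\<^sub>F i in net. F i \<in> V" by eventually_elim (use U in auto)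
  qed
qed

lemma limitin_weak_operator_topology:
  "limitin weak_operator_topology F T net \<longleftrightarrow>
     T \<in> B_ell2 \<and> (\<forall>\<^sub>F i in net. F i \<in> B_ell2) \<and>
     (\<forall>f g. ((\<lambda>i. cinner (F i f) g) \<longlongrightarrow> cinner (T f) g) net)"
  unfolding weak_operator_topology_def limitin_pullback_euclidean by auto

lemma limitin_strong_operator_topology:
  "limitin strong_operator_topology F T net \<longleftrightarrow> (\<forall>f. ((\<lambda>i. F i f) \<longlongrightarrow> T f) net)"
  for F :: "'b \<Rightarrow> 'a op"
  unfolding strong_operator_topology_def limitin_pullback_euclidean by auto


section \<open>The non-commutative analytic Toeplitz algebra\<close>

text \<open>
  The generators are indexed by a finite type \<open>'n\<close>, so that \<open>n = CARD('n)\<close>; the free semigroup is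
  \<open>'n list\<close> with concatenation, and \<open>\<xi>\<^sub>w\<close> is \<open>ket w\<close>.
\<close>

lift_definition left_shift :: "'n \<Rightarrow> 'n list ell2 \<Rightarrow> 'n list ell2" is
  "\<lambda>i f w. case w of [] \<Rightarrow> 0 | j # v \<Rightarrow> if j = i then f v else 0"
proof -
  fix i :: 'n and f :: "'n list \<Rightarrow> complex"
  let ?g = "\<lambda>w. (cmod (case w of [] \<Rightarrow> 0 | j # v \<Rightarrow> if j = i then f v else 0))\<^sup>2"
  assume "(\<lambda>x. (cmod (f x))\<^sup>2) summable_on UNIV"
  then have "?g summable_on (range ((#) i))"
    by (subst summable_on_reindex) (auto simp: o_def)
  then show "?g summable_on UNIV"
    by (rule summable_on_cong_neutral[THEN iffD1, rotated 3]) (auto split: list.splits)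
qed

lemma norm_left_shift: "norm (left_shift i f) = norm f"
proof -
  have "(\<Sum>\<^sub>\<infinity>w. (cmod (coord (left_shift i f) w))\<^sup>2)
      = (\<Sum>\<^sub>\<infinity>w\<in>range ((#) i). (cmod (coord (left_shift i f) w))\<^sup>2)"
    by (rule infsum_cong_neutral) (auto simp: left_shift.rep_eq split: list.splits)
  also have "\<dots> = (\<Sum>\<^sub>\<infinity>w. (cmod (coord f w))\<^sup>2)"
    by (subst infsum_reindex) (auto simp: o_def left_shift.rep_eq)
  finally show ?thesis by (simp add: norm_ell2_def)
qed

lift_definition L_gen :: "'n \<Rightarrow> 'n list op" is left_shift
proof (rule bounded_linear_intro)
  fix i :: 'n and r and f g :: "'n list ell2"
  show "left_shift i (f + g) = left_shift i f + left_shift i g"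
    by transfer (auto split: list.splits)
  show "left_shift i (r *\<^sub>R f) = r *\<^sub>R left_shift i f"
    unfolding scaleR_ell2_def by transfer (auto split: list.splits)
  show "norm (left_shift i f) \<le> norm f * 1" by (simp add: norm_left_shift)
qed

lemma L_gen_ket: "L_gen i (ket v) = ket (i # v)"
  by (rule ell2_eqI) (auto simp: L_gen.rep_eq left_shift.rep_eq ket.rep_eq split: list.splits)

lemma norm_L_gen: "norm (L_gen i f) = norm f"
  by (simp add: L_gen.rep_eq norm_left_shift)

lemma L_gen_B_ell2: "L_gen i \<in> B_ell2"
proof -
  have "left_shift i (cscale c f) = cscale c (left_shift i f)" for c f
    by transfer (auto simp: fun_eq_iff split: list.split)
  then show ?thesis by (simp add: B_ell2_def L_gen.rep_eq)
qed

definition unital_subalgebra :: "'a op set \<Rightarrow> bool" where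
  "unital_subalgebra \<A> \<longleftrightarrow> \<A> \<subseteq> B_ell2 \<and> id_blinfun \<in> \<A> \<and>
     (\<forall>S\<in>\<A>. \<forall>T\<in>\<A>. S + T \<in> \<A> \<and> S o\<^sub>L T \<in> \<A>) \<and>
     (\<forall>c. \<forall>T\<in>\<A>. scalar_op c o\<^sub>L T \<in> \<A>)"

definition nc_toeplitz_algebra :: "('n::finite) list op set" where
  "nc_toeplitz_algebra =
     \<Inter>{\<A>. unital_subalgebra \<A> \<and> closedin weak_operator_topology \<A> \<and> range L_gen \<subseteq> \<A>}"


section \<open>Bounded analytic functions on the disk\<close>

text \<open>
  An element of \<open>H\<^sup>\<infinity>\<close> is represented by a function on the plane whose values outside the open unit
  disk are irrelevant.
\<close>

definition Hinf :: "(complex \<Rightarrow> complex) set" where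
  "Hinf = {u. u holomorphic_on ball 0 1 \<and> bounded (u ` ball 0 1)}"

definition Hinf_norm :: "(complex \<Rightarrow> complex) \<Rightarrow> real" where
  "Hinf_norm u = (SUP z\<in>ball 0 1. cmod (u z))"

definition taylor_coeff :: "(complex \<Rightarrow> complex) \<Rightarrow> nat \<Rightarrow> complex" where
  "taylor_coeff u k = (deriv ^^ k) u 0 / fact k"

definition boundary_function :: "(complex \<Rightarrow> complex) \<Rightarrow> (real \<Rightarrow> complex) \<Rightarrow> bool" where
  "boundary_function u b \<longleftrightarrow>
     b \<in> borel_measurable (lebesgue_on {0..2*pi}) \<and>
     (AE \<theta> in lebesgue_on {0..2*pi}. ((\<lambda>r. u (of_real r * cis \<theta>)) \<longlongrightarrow> b \<theta>) (at_left 1))"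

text \<open>
  The weak* topology of \<open>H\<^sup>\<infinity>\<close> is the one it inherits, through boundary values, as a subspace of
  \<open>L\<^sup>\<infinity>\<close> of the circle, the dual of \<open>L\<^sup>1\<close>. By Fatou's theorem every function in \<open>H\<^sup>\<infinity>\<close> has a
  boundary function, unique almost everywhere, so the existential quantifiers below are no restriction.
\<close>

definition Hinf_weak_star_lim ::
    "(nat \<Rightarrow> complex \<Rightarrow> complex) \<Rightarrow> (complex \<Rightarrow> complex) \<Rightarrow> bool" where
  "Hinf_weak_star_lim U u \<longleftrightarrow> (\<forall>k. U k \<in> Hinf) \<and> u \<in> Hinf \<and>
     (\<exists>B b. (\<forall>k. boundary_function (U k) (B k)) \<and> boundary_function u b \<and>
        (\<forall>f. integrable (lebesgue_on {0..2*pi}) f \<longrightarrow>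
           (\<lambda>k. \<integral>\<theta>. B k \<theta> * f \<theta> \<partial>lebesgue_on {0..2*pi})
             \<longlonglongrightarrow> (\<integral>\<theta>. b \<theta> * f \<theta> \<partial>lebesgue_on {0..2*pi})))"


section \<open>The functional calculus\<close>

definition Abel_sum_op :: "(complex \<Rightarrow> complex) \<Rightarrow> 'a op \<Rightarrow> real \<Rightarrow> 'a op" where
  "Abel_sum_op u T r =
     (\<Sum>k. scalar_op (of_real (r ^ k) * taylor_coeff u k) o\<^sub>L op_pow T k)"

definition has_Hinf_calculus :: "'a op \<Rightarrow> bool" where
  "has_Hinf_calculus T \<longleftrightarrow> (\<exists>\<Phi> :: (complex \<Rightarrow> complex) \<Rightarrow> 'a op.
     (\<forall>u\<in>Hinf. \<Phi> u \<in> B_ell2 \<and>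
        (\<forall>r\<in>{0<..<1}.
           summable (\<lambda>k. scalar_op (of_real (r ^ k) * taylor_coeff u k) o\<^sub>L op_pow T k)) \<and>
        limitin strong_operator_topology (Abel_sum_op u T) (\<Phi> u) (at_left 1)) \<and>
     (\<forall>u\<in>Hinf. \<forall>v\<in>Hinf. \<Phi> (\<lambda>z. u z + v z) = \<Phi> u + \<Phi> v) \<and>
     (\<forall>c. \<forall>u\<in>Hinf. \<Phi> (\<lambda>z. c * u z) = scalar_op c o\<^sub>L \<Phi> u) \<and>
     (\<forall>u\<in>Hinf. \<forall>v\<in>Hinf. \<Phi> (\<lambda>z. u z * v z) = \<Phi> u o\<^sub>L \<Phi> v) \<and>
     \<Phi> (\<lambda>z. 1) = id_blinfun \<and>
     \<Phi> (\<lambda>z. z) = T \<and>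
     (\<forall>u\<in>Hinf. norm (\<Phi> u) \<le> Hinf_norm u) \<and>
     (\<forall>U u. Hinf_weak_star_lim U u \<longrightarrow>
        limitin weak_operator_topology (\<lambda>k. \<Phi> (U k)) (\<Phi> u) sequentially))"

end

theory Submission
  imports Defs "HOL-Complex_Analysis.Cauchy_Integral_Formula"
begin

text \<open>
  Let \<open>S\<close> be the adjoint of a contraction \<open>T\<close> in the Toeplitz algebra. The
  operator \<open>T\<close> commutes with the right translations \<open>ket u \<mapsto> ket (u @
  v)\<close>, because the generators do and because commuting is a weakly closed condition. Hence
  \<open>T\<close> is determined by \<open>T (ket [])\<close> and is triangular for the length
  grading, with constant diagonal \<open>c\<close>, the coefficient of \<open>T (ket [])\<close> at
  the empty word. If \<open>c\<close> had modulus one, \<open>T\<close> would be the unitary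
  \<open>c \<cdot> 1\<close> (\<open>toeplitz_vacuum_coefficient\<close>). Otherwise every
  \<open>ket w\<close> is, up to shorter words, an eigenvector of \<open>S\<close> for an eigenvalue
  inside the disk, so that \<open>\<Sum>k. \<parallel>S\<^sup>k (ket w)\<parallel>\<close> is finite
  (\<open>toeplitz_adjoint_stable_ket\<close>). Thus the vectors with summable orbits under
  \<open>S\<close>, called stable, are dense. The rest of the argument concerns any contraction with
  this property.

  For stable \<open>f\<close> and \<open>g\<close> the operator Poisson kernel \<open>P f g\<close>
  of \<open>T\<close> is a continuous function on the circle itself. Contractivity of
  \<open>T\<close> makes it positive (\<open>poisson_nonneg\<close>), and its Fourier coefficients
  are the numbers \<open>\<langle>T\<^sup>k f, g\<rangle>\<close>, so \<open>\<langle>a(T) f,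
  g\<rangle>\<close> is the normalised integral of \<open>a(z)\<close> against \<open>P f g\<close>.
  Schwarz's inequality for the kernel then bounds \<open>\<parallel>a(T)
  f\<parallel>\<^sup>2\<close> by the normalised integral of \<open>\<bar>a\<bar>\<^sup>2 P f
  f\<close> (\<open>norm_op_series_le_integral\<close>). Estimating \<open>\<bar>a\<bar>\<close> by
  its supremum gives von Neumann's inequality. Estimating \<open>P f f\<close> by its supremum gives
  a bound by the \<open>\<ell>\<^sub>2\<close>-norm of the coefficients, and since functions in
  \<open>H\<^sup>\<infinity>\<close> have square-summable Taylor coefficients, the Abel means
  converge on stable vectors; the uniform bound extends strong convergence to all vectors
  (\<open>Abel_strong_limit\<close>). The algebraic properties pass to the limit from absolutely
  convergent power series.

  For weak-star continuity, letting \<open>r \<rightarrow> 1\<close> in the integral formula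
  represents \<open>\<langle>u(T) f, g\<rangle>\<close> by integrating the boundary function of
  \<open>u\<close> against an \<open>L\<^sup>1\<close> density of norm at most
  \<open>\<parallel>f\<parallel> \<parallel>g\<parallel>\<close>. Expanding arbitrary
  \<open>f\<close> and \<open>g\<close> in norm-summable series of stable vectors and adding up the
  densities gives an \<open>L\<^sup>1\<close> density for every pair of vectors
  (\<open>L1_density_calculus\<close>), and convergence against such densities is what weak-star
  convergence means.
\<close>

section \<open>The complex inner product of square-summable families\<close>

lemma cinner_add_left: "cinner (f + g) h = cinner f h + cinner g h"
  unfolding cinner_def plus_ell2.rep_eq
  by (simp add: distrib_right infsum_add coord_product_summable)

lemma cinner_commute: "cinner g f = cnj (cinner f g)"
  unfolding cinner_def infsum_cnj[symmetric] by (simp add: mult.commute)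

lemma cinner_cscale_left: "cinner (cscale c f) g = c * cinner f g"
  unfolding cinner_def cscale.rep_eq by (simp add: mult.assoc infsum_cmult_right')

lemma cinner_add_right: "cinner h (f + g) = cinner h f + cinner h g"
  using cinner_add_left[of f g h] by (metis cinner_commute complex_cnj_add)

lemma cinner_cscale_right: "cinner f (cscale c g) = cnj c * cinner f g"
  using cinner_cscale_left[of c g f] by (metis cinner_commute complex_cnj_mult)

lemma scaleR_cscale: "r *\<^sub>R f = cscale (of_real r) f"
  by (rule scaleR_ell2_def)

lemma cscale_cscale: "cscale c (cscale d f) = cscale (c * d) f"
  by transfer (simp add: mult.assoc)

lemma cscale_1 [simp]: "cscale 1 f = f"
  by transfer simp

lemma Re_cinner_self: "Re (cinner f f) = (norm f)\<^sup>2"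
  by (simp add: cinner_self norm_ell2_squared)

lemma cinner_norm_self: "cinner f f = of_real ((norm f)\<^sup>2)"
  by (simp add: cinner_self norm_ell2_squared)

text \<open>
  The real inner product of the type is the real part of \<open>cinner\<close>; rotating the first
  argument so that the inner product becomes nonnegative turns the real Cauchy-Schwarz inequality
  into the complex one.
\<close>

lemma cmod_cinner_le: "cmod (cinner f g) \<le> norm f * norm g"
proof (cases "cinner f g = 0")
  case False
  define c where "c = cnj (sgn (cinner f g))"
  have c: "cmod c = 1" using False by (simp add: c_def norm_sgn)
  have "cinner f g * cnj (cinner f g) = of_real (cmod (cinner f g)) * of_real (cmod (cinner f g))"
    by (simp add: complex_norm_square[symmetric] power2_eq_square)
  then have "c * cinner f g = of_real (cmod (cinner f g))"
    using False by (simp add: c_def sgn_eq mult.commute)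
  then have "cmod (cinner f g) = inner (cscale c f) g"
    by (simp add: inner_ell2_def cinner_cscale_left)
  also have "\<dots> \<le> norm (cscale c f) * norm g" by (rule norm_cauchy_schwarz)
  finally show ?thesis by (simp add: norm_cscale c)
qed simp

interpretation cinner: bounded_bilinear cinner
proof
  show "\<exists>K. \<forall>a b. norm (cinner a b) \<le> norm a * norm b * K"
    by (rule exI[of _ 1]) (simp add: cmod_cinner_le)
qed (auto simp: cinner_add_left cinner_add_right scaleR_cscale cinner_cscale_left
        cinner_cscale_right scaleR_conv_of_real)

interpretation cscale: bounded_bilinear cscale
proof
  show "\<exists>K. \<forall>a b. norm (cscale a b) \<le> norm a * norm b * K"
    by (rule exI[of _ 1]) (simp add: norm_cscale)
  fix a a' :: complex and b b' :: "'a ell2" and r :: real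
  show "cscale (a + a') b = cscale a b + cscale a' b" by transfer (simp add: algebra_simps)
  show "cscale a (b + b') = cscale a b + cscale a b'" by transfer (simp add: algebra_simps)
  show "cscale (r *\<^sub>R a) b = r *\<^sub>R cscale a b" 
    unfolding scaleR_cscale cscale_cscale by (simp add: scaleR_conv_of_real)
  show "cscale a (r *\<^sub>R b) = r *\<^sub>R cscale a b" 
    unfolding scaleR_cscale cscale_cscale by (simp add: mult.commute)
qed

lemma coord_ket: "coord (ket x) y = (if y = x then 1 else 0)"
  by (rule ket.rep_eq[THEN fun_cong])

lemma cinner_ket_right: "cinner f (ket x) = coord f x"
proof -
  have "cinner f (ket x) = (\<Sum>\<^sub>\<infinity>y\<in>{x}. coord f y * cnj (coord (ket x) y))"
    unfolding cinner_def by (rule infsum_cong_neutral) (auto simp: coord_ket)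
  then show ?thesis by (simp add: coord_ket)
qed

lemma coord_ket_sum: "finite F \<Longrightarrow> coord (\<Sum>x\<in>F. cscale (c x) (ket x)) y = (if y \<in> F then c y else 0)"
  by (induction F rule: finite_induct)
     (auto simp: zero_ell2.rep_eq plus_ell2.rep_eq cscale.rep_eq coord_ket)

lemma norm_finite_support:
  assumes "finite F" "\<And>x. x \<notin> F \<Longrightarrow> coord f x = 0"
  shows "(norm f)\<^sup>2 = (\<Sum>x\<in>F. (cmod (coord f x))\<^sup>2)"
proof -
  have "(norm f)\<^sup>2 = (\<Sum>\<^sub>\<infinity>x\<in>F. (cmod (coord f x))\<^sup>2)"
    unfolding norm_ell2_squared by (rule infsum_cong_neutral) (use assms in auto)
  then show ?thesis using assms by simp
qed

lemma finite_approximation: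
  assumes "0 < e"
  shows "\<exists>F. finite F \<and> norm (f - (\<Sum>x\<in>F. cscale (coord f x) (ket x))) < e"
proof -
  let ?q = "\<lambda>x. (cmod (coord f x))\<^sup>2"
  obtain F where F: "finite F" "dist (\<Sum>x\<in>F. ?q x) (\<Sum>\<^sub>\<infinity>x. ?q x) \<le> e\<^sup>2 / 2"
    using infsum_finite_approximation[OF coord_summable[of f], of "e\<^sup>2 / 2"] assms by auto
  have "0 < e\<^sup>2" using assms by simp
  define h where "h = f - (\<Sum>x\<in>F. cscale (coord f x) (ket x))"
  have ch: "coord h y = (if y \<in> F then 0 else coord f y)" for y
    by (simp add: h_def coord_diff coord_ket_sum F)
  have "(norm h)\<^sup>2 = (\<Sum>\<^sub>\<infinity>x\<in>UNIV - F. ?q x)"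
    unfolding norm_ell2_squared by (rule infsum_cong_neutral) (auto simp: ch)
  also have "\<dots> = (\<Sum>\<^sub>\<infinity>x. ?q x) - (\<Sum>\<^sub>\<infinity>x\<in>F. ?q x)"
    by (rule infsum_Diff) (auto simp: coord_summable F)
  also have "\<dots> < e\<^sup>2" using F(2) \<open>0 < e\<^sup>2\<close> infsum_finite[OF F(1), of ?q] unfolding dist_real_def by linarith
  finally have "norm h < e" using assms by (intro power2_less_imp_less[of _ e]) auto
  then show ?thesis using F h_def by auto
qed

text \<open>
  A closed condition that passes to linear combinations need only be checked on basis vectors.
\<close>

lemma ell2_dense_induct [case_names closed zero add scale ket]:
  assumes "closed {f. P f}" and "P 0" and "\<And>f g. P f \<Longrightarrow> P g \<Longrightarrow> P (f + g)"
    and "\<And>c f. P f \<Longrightarrow> P (cscale c f)" and "\<And>x. P (ket x)"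
  shows "P f"
proof -
  have "P (\<Sum>x\<in>F. cscale (coord f x) (ket x))" if "finite F" for F
    using that by (induction F rule: finite_induct) (auto intro: assms)
  then have near: "\<exists>g. P g \<and> dist g f < e" if "0 < e" for e
    using finite_approximation[OF that, of f] by (metis dist_norm dist_commute)
  have "f \<in> closure {f. P f}" unfolding closure_approachable using near by blast
  then show ?thesis using assms(1) by simp
qed

lemma ell2_eq_cinnerI: "(\<And>h. cinner f h = cinner g h) \<Longrightarrow> f = g"
  by (rule ell2_eqI) (metis cinner_ket_right)

lemma ell2_eq_cinner_leftI: "(\<And>h. cinner h f = cinner h g) \<Longrightarrow> f = g"
  by (rule ell2_eq_cinnerI) (metis cinner_commute)

lemma B_ell2_cscale: "T \<in> B_ell2 \<Longrightarrow> T (cscale c f) = cscale c (T f)"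
  by (simp add: B_ell2_def)

text \<open>
  The adjoint is built coordinatewise: \<open>S g\<close> must have \<open>x\<close>-th coordinate
  \<open>c x\<close>, the conjugate of \<open>\<langle>T (ket x), g\<rangle>\<close>. Testing
  \<open>T\<close> against the finite sum \<open>h\<close> of the \<open>c x\<close>-multiples of
  basis vectors gives \<open>\<parallel>h\<parallel>\<^sup>2 = \<langle>T h, g\<rangle> \<le>
  \<parallel>T\<parallel> \<parallel>h\<parallel> \<parallel>g\<parallel>\<close>, so these
  coordinates are square-summable. Only the map is needed later, so \<open>S\<close> is left a plain
  function; its linearity and boundedness follow from the adjoint equation.
\<close>

lemma adjoint_exists:
  fixes T :: "'a op"
  assumes T: "T \<in> B_ell2"
  shows "\<exists>S. \<forall>f g. cinner (T f) g = cinner f (S g)"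
proof -
  have "\<exists>s. \<forall>f. cinner (T f) g = cinner f s" for g
  proof -
    define c where "c x = cnj (cinner (T (ket x)) g)" for x
    have fin: "(\<Sum>x\<in>F. (cmod (c x))\<^sup>2) \<le> (norm T * norm g)\<^sup>2" if "finite F" for F
    proof -
      define h where "h = (\<Sum>x\<in>F. cscale (c x) (ket x))"
      define q where "q = (\<Sum>x\<in>F. (cmod (c x))\<^sup>2)"
      have q: "(norm h)\<^sup>2 = q"
        by (subst norm_finite_support[OF that]) (auto simp: h_def q_def coord_ket_sum that)
      have cq: "c x * cinner (T (ket x)) g = of_real ((cmod (c x))\<^sup>2)" for x
        unfolding complex_norm_square by (simp add: c_def)
      have "cinner (T h) g = (\<Sum>x\<in>F. c x * cinner (T (ket x)) g)"
        by (simp add: h_def blinfun.sum_right cinner.sum_left B_ell2_cscale[OF T] cinner_cscale_left)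
      also have "\<dots> = of_real q"
        unfolding q_def of_real_sum
        by (rule sum.cong[OF refl]) (rule cq)
      finally have "q = cmod (cinner (T h) g)" unfolding q[symmetric] by (simp del: of_real_power)
      also have "\<dots> \<le> norm (T h) * norm g" by (rule cmod_cinner_le)
      also have "\<dots> \<le> norm T * norm h * norm g"
        by (intro mult_right_mono norm_blinfun) auto
      finally have "norm h * norm h \<le> (norm T * norm g) * norm h"
        by (simp add: q[symmetric] power2_eq_square mult_ac)
      then have "norm h \<le> norm T * norm g"
        by (cases "norm h = 0") (auto simp: mult_le_cancel_right)
      then show ?thesis unfolding q_def[symmetric] q[symmetric] by (intro power_mono) auto
    qed
    have "(\<lambda>x. (cmod (c x))\<^sup>2) summable_on UNIV"
      by (rule nonneg_bdd_above_summable_on) (use fin in \<open>auto intro!: bdd_aboveI\<close>)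
    then have s: "coord (Abs_ell2 c) = c" by (simp add: Abs_ell2_inverse)
    have "cinner (T f) g = cinner f (Abs_ell2 c)" for f
    proof (induction f rule: ell2_dense_induct)
      case closed show ?case
        by (intro closed_Collect_eq cinner.continuous_on blinfun.continuous_on continuous_on_const continuous_on_id)
    next
      case (ket x)
      have "cinner (ket x) (Abs_ell2 c) = cnj (c x)"
        using cinner_ket_right[of "Abs_ell2 c" x] s by (metis cinner_commute)
      also have "\<dots> = cinner (T (ket x)) g" by (simp add: c_def)
      finally show ?case by simp
    qed (auto simp: blinfun.add_right cinner_add_left B_ell2_cscale[OF T] cinner_cscale_left
           cinner.zero_left)
    then show ?thesis by blast
  qed
  then show ?thesis by metis
qed


section \<open>Right translations and the commutant\<close>

text \<open>
  \<open>right_mult v\<close> sends \<open>ket u\<close> to \<open>ket (u @ v)\<close>; since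
  \<open>u \<mapsto> u @ v\<close> is injective, it merely relabels coordinates.
\<close>

lift_definition right_mult :: "'n list \<Rightarrow> 'n list ell2 \<Rightarrow> 'n list ell2" is
  "\<lambda>v f w. if w \<in> range (\<lambda>u. u @ v) then f (take (length w - length v) w) else 0"
proof -
  fix v :: "'n list" and f :: "'n list \<Rightarrow> complex"
  let ?g = "\<lambda>w. (cmod (if w \<in> range (\<lambda>u. u @ v) then f (take (length w - length v) w) else 0))\<^sup>2"
  assume "(\<lambda>x. (cmod (f x))\<^sup>2) summable_on UNIV"
  then have "?g summable_on (range (\<lambda>u. u @ v))"
    by (subst summable_on_reindex) (auto simp: o_def inj_on_def)
  then show "?g summable_on UNIV"
    by (rule summable_on_cong_neutral[THEN iffD1, rotated 3]) auto
qed

lemma coord_right_mult_append: "coord (right_mult v f) (u @ v) = coord f u"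
  by (auto simp: right_mult.rep_eq)

lemma coord_right_mult_outside: "(\<And>u. w \<noteq> u @ v) \<Longrightarrow> coord (right_mult v f) w = 0"
  by (auto simp: right_mult.rep_eq)

lemma right_mult_eqI:
  assumes "\<And>u. coord g (u @ v) = coord f u" and "\<And>w. (\<And>u. w \<noteq> u @ v) \<Longrightarrow> coord g w = 0"
  shows "g = right_mult v f"
proof (rule ell2_eqI)
  fix w show "coord g w = coord (right_mult v f) w"
    using assms by (cases "\<exists>u. w = u @ v") (auto simp: coord_right_mult_append coord_right_mult_outside)
qed

lemma right_mult_add: "right_mult v (f + g) = right_mult v f + right_mult v g"
  by (rule right_mult_eqI[symmetric])
     (simp_all add: plus_ell2.rep_eq coord_right_mult_append coord_right_mult_outside)

lemma right_mult_cscale: "right_mult v (cscale c f) = cscale c (right_mult v f)"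
  by (rule right_mult_eqI[symmetric])
     (simp_all add: cscale.rep_eq coord_right_mult_append coord_right_mult_outside)

lemma right_mult_ket_Nil: "right_mult v (ket []) = ket v"
  by (rule right_mult_eqI[symmetric]) (auto simp: coord_ket)

text \<open>
  Prepending a letter and appending a word commute. In coordinates the only delicate words are those
  too short to end in \<open>v\<close> once their first letter is removed; there both sides vanish.
\<close>

lemma L_gen_right_mult: "L_gen i (right_mult v f) = right_mult v (L_gen i f)"
proof (rule right_mult_eqI)
  fix u show "coord (L_gen i (right_mult v f)) (u @ v) = coord (L_gen i f) u"
  proof (cases u)
    case Nil
    have "coord (left_shift i (right_mult v f)) v = 0"
    proof (cases v)
      case (Cons j v')
      have "coord (right_mult v f) v' = 0"
        by (rule coord_right_mult_outside) (use Cons in \<open>auto dest: arg_cong[where f = length]\<close>)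
      then show ?thesis by (subst Cons) (auto simp: left_shift.rep_eq)
    qed (simp add: left_shift.rep_eq)
    then show ?thesis using Nil by (simp add: L_gen.rep_eq left_shift.rep_eq)
  next
    case (Cons j u')
    then show ?thesis by (auto simp: L_gen.rep_eq left_shift.rep_eq coord_right_mult_append)
  qed
next
  fix w :: "'a list" assume w: "\<And>u. w \<noteq> u @ v"
  show "coord (L_gen i (right_mult v f)) w = 0"
  proof (cases w)
    case (Cons j w')
    have "coord (right_mult v f) w' = 0"
      by (rule coord_right_mult_outside) (use w Cons in \<open>metis append_Cons\<close>)
    then show ?thesis using Cons by (simp add: L_gen.rep_eq left_shift.rep_eq)
  qed (simp add: L_gen.rep_eq left_shift.rep_eq)
qed

text \<open>
  Every operator in the Toeplitz algebra commutes with right translations: the operators that do so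
  form a unital algebra that contains the generators, and commuting can be tested on matrix
  coefficients, hence is a weakly closed condition.
\<close>

definition right_mult_commutant :: "'n list op set" where
  "right_mult_commutant = {S \<in> B_ell2. \<forall>v f. S (right_mult v f) = right_mult v (S f)}"

lemma scalar_op_apply [simp]: "scalar_op c f = cscale c f"
  by (simp add: scalar_op.rep_eq)

lemma scalar_op_B_ell2: "scalar_op c \<in> B_ell2"
  by (simp add: B_ell2_def cscale_cscale mult.commute)

lemma B_ell2_add: "S \<in> B_ell2 \<Longrightarrow> T \<in> B_ell2 \<Longrightarrow> S + T \<in> B_ell2"
  by (simp add: B_ell2_def blinfun.add_left cscale.add_right)

lemma B_ell2_compose: "S \<in> B_ell2 \<Longrightarrow> T \<in> B_ell2 \<Longrightarrow> S o\<^sub>L T \<in> B_ell2"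
  by (simp add: B_ell2_def)

lemma B_ell2_id: "id_blinfun \<in> B_ell2"
  by (simp add: B_ell2_def)

lemma unital_subalgebra_commutant: "unital_subalgebra right_mult_commutant"
  unfolding unital_subalgebra_def right_mult_commutant_def
  by (auto simp: B_ell2_id B_ell2_add B_ell2_compose scalar_op_B_ell2 blinfun.add_left
       right_mult_add right_mult_cscale)

lemma closedin_pullback_euclidean:
  fixes P :: "'b \<Rightarrow> 'c::topological_space"
  assumes "closed C"
  shows "closedin (pullback_topology A P euclidean) (P -` C \<inter> A)"
  unfolding closedin_def topspace_pullback_topology openin_pullback_topology
  using assms by (intro conjI exI[of _ "- C"]) (auto simp: open_closed)

lemma closedin_commutant: "closedin weak_operator_topology right_mult_commutant"
proof -
  \<comment> \<open>Commutation read off on matrix coefficients, as a closed condition on functions of pairs of vectors.\<close>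
  define C :: "('a list ell2 \<times> 'a list ell2 \<Rightarrow> complex) set" where
    "C = {p. \<forall>v f w. p (right_mult v f, ket w) =
      (if w \<in> range (\<lambda>u. u @ v) then p (f, ket (take (length w - length v) w)) else 0)}"
  have cont: "continuous_on UNIV (\<lambda>p :: 'a list ell2 \<times> 'a list ell2 \<Rightarrow> complex. p x)" for x
    by simp
  have cont': "continuous_on UNIV (\<lambda>p :: 'a list ell2 \<times> 'a list ell2 \<Rightarrow> complex. 
      if b then p x else 0)" for x b
    by (cases b) auto
  have "closed C" unfolding C_def
    by (intro closed_Collect_all closed_Collect_eq cont cont')
  moreover have eq: "right_mult_commutant = (\<lambda>T (f, g). cinner (blinfun_apply T f) g) -` C \<inter> B_ell2"
  proof -
    have "(S (right_mult v f) = right_mult v (S f)) \<longleftrightarrow>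
      (\<forall>w. cinner (S (right_mult v f)) (ket w) = (if w \<in> range (\<lambda>u. u @ v) 
         then cinner (S f) (ket (take (length w - length v) w)) else 0))" for S :: "'a list op" and v f
      unfolding cinner_ket_right coord_inject[symmetric] fun_eq_iff right_mult.rep_eq by simp
    then show ?thesis by (auto simp: right_mult_commutant_def C_def)
  qed
  ultimately show ?thesis
    unfolding weak_operator_topology_def eq by (intro closedin_pullback_euclidean)
qed

lemma toeplitz_commutes_right_mult:
  assumes "T \<in> nc_toeplitz_algebra"
  shows "T \<in> B_ell2" and "T (right_mult v f) = right_mult v (T f)"
proof -
  have "range L_gen \<subseteq> right_mult_commutant"
    by (auto simp: right_mult_commutant_def L_gen_B_ell2 L_gen_right_mult)
  with unital_subalgebra_commutant closedin_commutant
  have "right_mult_commutant \<in> {\<A>. unital_subalgebra \<A> \<and>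
      closedin weak_operator_topology \<A> \<and> range L_gen \<subseteq> \<A>}"
    by simp
  then have "T \<in> right_mult_commutant"
    by (rule InterD[OF assms[unfolded nc_toeplitz_algebra_def]])
  then show "T \<in> B_ell2" "T (right_mult v f) = right_mult v (T f)"
    by (auto simp: right_mult_commutant_def)
qed

lemma toeplitz_ket:
  assumes "T \<in> nc_toeplitz_algebra"
  shows "T (ket v) = right_mult v (T (ket []))"
  using toeplitz_commutes_right_mult(2)[OF assms, of v "ket []"] by (simp add: right_mult_ket_Nil)

lemma unitary_scalar_op:
  assumes "cmod c = 1" and T: "T = scalar_op c"
  shows "unitary_op T"
  unfolding unitary_op_def
proof (intro conjI exI[of _ "scalar_op (cnj c)"])
  show "T \<in> B_ell2" unfolding T by (rule scalar_op_B_ell2)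
  have c: "c * cnj c = 1" using assms(1) by (simp add: complex_norm_square[symmetric])
  show "adjoint_of T (scalar_op (cnj c))"
    by (simp add: adjoint_of_def T scalar_op_B_ell2 cinner_cscale_left cinner_cscale_right)
  have c': "cnj c * c = 1" using c by (simp only: mult.commute)
  show "scalar_op (cnj c) o\<^sub>L T = id_blinfun"
    by (rule blinfun_eqI) (simp add: T cscale_cscale c')
  show "T o\<^sub>L scalar_op (cnj c) = id_blinfun"
    by (rule blinfun_eqI) (simp add: T cscale_cscale c)
qed

text \<open>
  If the coefficient \<open>c\<close> of \<open>T (ket [])\<close> at the empty word had modulus
  one, it would exhaust the norm of \<open>T (ket [])\<close>, so \<open>T (ket []) = c \<cdot> ket
  []\<close>; commuting with right translations would propagate this to all of \<open>T\<close>,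
  making \<open>T\<close> a unimodular scalar and therefore unitary.
\<close>

lemma toeplitz_vacuum_coefficient:
  assumes T: "T \<in> nc_toeplitz_algebra" and "norm T \<le> 1" and "\<not> unitary_op T"
  shows "cmod (coord (T (ket [])) []) < 1"
proof (rule ccontr)
  define h where "h = T (ket [])"
  define c where "c = coord h []"
  assume "\<not> cmod (coord (T (ket [])) []) < 1"
  then have c1: "1 \<le> cmod c" by (simp add: c_def h_def)
  have "(norm (ket ([] :: 'a list)))\<^sup>2 = 1"
    by (subst norm_finite_support[of "{[]}"]) (auto simp: coord_ket)
  then have "norm (ket ([] :: 'a list)) = 1"
    using power2_eq_imp_eq[of "norm (ket ([] :: 'a list))" 1] by simp
  then have h1: "norm h \<le> 1"
    using norm_blinfun[of T "ket []"] assms(2) by (simp add: h_def)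
  then have h2: "(norm h)\<^sup>2 \<le> 1" by (simp add: power_le_one)
  have c2: "(cmod c)\<^sup>2 \<ge> 1" using c1 by simp
  have zero: "coord h w = 0" if "w \<noteq> []" for w
  proof -
    have "(cmod c)\<^sup>2 + (cmod (coord h w))\<^sup>2 \<le> (norm h)\<^sup>2"
      using sum_le_norm_ell2[of "{[], w}" h] that by (simp add: c_def)
    then have "(cmod (coord h w))\<^sup>2 \<le> 0" using h2 c2 by linarith
    then show ?thesis by simp
  qed
  have "(cmod c)\<^sup>2 \<le> (norm h)\<^sup>2" using sum_le_norm_ell2[of "{[]}" h] by (simp add: c_def)
  with h2 c2 have "(cmod c)\<^sup>2 = 1" by linarith
  then have "cmod c = 1" using power2_eq_imp_eq[of "cmod c" 1] by simp
  moreover have "T = scalar_op c"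
  proof (rule blinfun_eqI)
    have h: "h = cscale c (ket [])"
      by (rule ell2_eqI) (auto simp: cscale.rep_eq coord_ket zero c_def)
    fix f show "T f = scalar_op c f"
    proof (induction f rule: ell2_dense_induct)
      case closed show ?case
        by (intro closed_Collect_eq blinfun.continuous_on continuous_on_const continuous_on_id)
    next
      case (ket v)
      have "T (ket v) = right_mult v h" unfolding h_def by (rule toeplitz_ket[OF T])
      then show ?case by (simp add: h right_mult_cscale right_mult_ket_Nil)
    next
      case zero show ?case by (simp only: blinfun.zero_right)
    next
      case (add f g) then show ?case by (simp only: blinfun.add_right)
    next
      case (scale d f) then show ?case
        by (simp only: B_ell2_cscale[OF toeplitz_commutes_right_mult(1)[OF T]]
             B_ell2_cscale[OF scalar_op_B_ell2])
    qed
  qed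
  ultimately have "unitary_op T" by (rule unitary_scalar_op)
  then show False using assms(3) by simp
qed


section \<open>Vectors with summable orbits under the adjoint\<close>

locale adjoint_pair =
  fixes T :: "'a op" and S :: "'a ell2 \<Rightarrow> 'a ell2"
  assumes linear_op: "T \<in> B_ell2" and adj: "\<And>f g. cinner (T f) g = cinner f (S g)"
begin

lemma S_add: "S (f + g) = S f + S g"
  by (rule ell2_eq_cinner_leftI) (simp add: adj[symmetric] cinner_add_right)

lemma S_cscale: "S (cscale c f) = cscale c (S f)"
  by (rule ell2_eq_cinner_leftI) (simp add: adj[symmetric] cinner_cscale_right)

lemma norm_S_le: "norm (S g) \<le> norm T * norm g"
proof -
  have "(norm (S g))\<^sup>2 = cmod (cinner (T (S g)) g)"
    by (simp add: adj cinner_norm_self norm_power)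
  also have "\<dots> \<le> norm (T (S g)) * norm g" by (rule cmod_cinner_le)
  also have "\<dots> \<le> norm T * norm (S g) * norm g"
    by (intro mult_right_mono norm_blinfun) auto
  finally have "norm (S g) * norm (S g) \<le> (norm T * norm g) * norm (S g)"
    by (simp add: power2_eq_square mult_ac)
  then show ?thesis by (cases "norm (S g) = 0") (auto simp: mult_le_cancel_right)
qed

sublocale S: bounded_linear S
proof
  show "\<exists>K. \<forall>x. norm (S x) \<le> norm x * K"
    by (intro exI[of _ "norm T"] allI, subst mult.commute) (rule norm_S_le)
qed (auto simp: S_add S_cscale scaleR_cscale)

lemma Spow_add: "(S ^^ k) (f + g) = (S ^^ k) f + (S ^^ k) g"
  by (induction k) (auto simp: S_add)

lemma Spow_zero: "(S ^^ k) 0 = 0"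
  by (induction k) (auto simp: S.zero)

lemma Spow_cscale: "(S ^^ k) (cscale c f) = cscale c ((S ^^ k) f)"
  by (induction k) (auto simp: S_cscale)

text \<open>
  Vectors whose orbit under the adjoint is absolutely summable. On them all generating series of the
  orbit converge uniformly on the closed disk, so that no radial limits are needed there.
\<close>

definition stable :: "'a ell2 \<Rightarrow> bool" where
  "stable f \<longleftrightarrow> summable (\<lambda>k. norm ((S ^^ k) f))"

lemma stable_zero: "stable 0"
  by (simp add: stable_def Spow_zero)

lemma stable_add: "stable f \<Longrightarrow> stable g \<Longrightarrow> stable (f + g)"
  unfolding stable_def Spow_add
  by (drule (1) summable_add) (rule summable_comparison_test', assumption, simp add: norm_triangle_ineq)

lemma stable_cscale: "stable f \<Longrightarrow> stable (cscale c f)"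
  unfolding stable_def Spow_cscale norm_cscale by (rule summable_mult)

lemma stable_diff: "stable f \<Longrightarrow> stable g \<Longrightarrow> stable (f - g)"
  using stable_add[of f "cscale (-1) g"] stable_cscale[of g "-1"]
  by (simp add: cscale.minus_left)

lemma stable_sum: "(\<And>x. x \<in> F \<Longrightarrow> stable (h x)) \<Longrightarrow> stable (\<Sum>x\<in>F. h x)"
  by (induction F rule: infinite_finite_induct) (auto intro: stable_zero stable_add)

text \<open>
  Applying the powers of \<open>S\<close> to \<open>S f = c f + d\<close> gives, for the norms
  \<open>a k\<close> of the orbit of \<open>f\<close> and \<open>b k\<close> of the orbit of
  \<open>d\<close>, the recursion \<open>a (Suc k) \<le> \<bar>c\<bar> a k + b k\<close>; a summable
  forcing term and a factor below one make \<open>a\<close> summable.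
\<close>

lemma stable_of_eigen_defect:
  assumes c: "cmod c < 1" and d: "stable (S f - cscale c f)"
  shows "stable f"
proof -
  define a where "a k = norm ((S ^^ k) f)" for k
  define b where "b k = norm ((S ^^ k) (S f - cscale c f))" for k
  have step: "a (Suc k) \<le> cmod c * a k + b k" for k
  proof -
    have "(S ^^ Suc k) f = (S ^^ k) (cscale c f + (S f - cscale c f))"
      by (simp add: funpow_Suc_right del: funpow.simps)
    then show ?thesis
      using norm_triangle_ineq[of "cscale c ((S ^^ k) f)" "(S ^^ k) (S f - cscale c f)"]
      unfolding a_def b_def Spow_add Spow_cscale norm_cscale by simp
  qed
  have "(\<Sum>k<n. a k) \<le> (a 0 + suminf b) / (1 - cmod c)" for n
  proof -
    have "(\<Sum>k<n. a k) \<le> (\<Sum>k<Suc n. a k)" by (simp add: a_def)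
    also have "\<dots> = a 0 + (\<Sum>k<n. a (Suc k))" by (rule sum.lessThan_Suc_shift)
    also have "\<dots> \<le> a 0 + (\<Sum>k<n. cmod c * a k + b k)"
      by (intro add_left_mono sum_mono step)
    also have "\<dots> = a 0 + cmod c * (\<Sum>k<n. a k) + (\<Sum>k<n. b k)"
      by (simp add: sum.distrib sum_distrib_left)
    also have "(\<Sum>k<n. b k) \<le> suminf b"
      by (rule sum_le_suminf) (use d in \<open>auto simp: stable_def b_def\<close>)
    finally have "(\<Sum>k<n. a k) * (1 - cmod c) \<le> a 0 + suminf b" by (simp add: algebra_simps)
    then show ?thesis using c by (simp add: pos_le_divide_eq)
  qed
  then show ?thesis unfolding stable_def a_def[symmetric]
    by (intro summableI_nonneg_bounded) (auto simp: a_def)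
qed

end

text \<open>
  By the commutation with right translations, \<open>S (ket w)\<close> is a combination of basis
  vectors \<open>ket v\<close> with \<open>v\<close> a suffix of \<open>w\<close>, and the suffix
  \<open>w\<close> itself carries the conjugate of the coefficient of \<open>T (ket [])\<close> at
  the empty word, which has modulus below one. So \<open>ket w\<close> is an eigenvector of
  \<open>S\<close> up to a combination of shorter words, and the claim follows by induction on the
  length.
\<close>

lemma toeplitz_adjoint_stable_ket:
  assumes "T \<in> nc_toeplitz_algebra" "norm T \<le> 1" "\<not> unitary_op T"
    and "adjoint_pair T S"
  shows "adjoint_pair.stable S (ket w)"
proof -
  interpret adjoint_pair T S by fact
  define h where "h = T (ket [])"
  define c where "c = cnj (coord h [])"
  have c: "cmod c < 1" using toeplitz_vacuum_coefficient[OF assms(1-3)] by (simp add: c_def h_def)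
  show ?thesis
  proof (induction "length w" arbitrary: w rule: less_induct)
    case less
    define V where "V = {v. \<exists>u. w = u @ v}"
    define a where "a v = cnj (coord (right_mult v h) w)" for v
    have "V \<subseteq> (\<lambda>n. drop n w) ` {..length w}"
    proof
      fix v assume "v \<in> V"
      then obtain u where "w = u @ v" by (auto simp: V_def)
      then have "v = drop (length u) w" "length u \<le> length w" by auto
      then show "v \<in> (\<lambda>n. drop n w) ` {..length w}" by blast
    qed
    then have fin: "finite V" by (rule finite_subset) simp
    have "S (ket w) = (\<Sum>v\<in>V. cscale (a v) (ket v))"
    proof (rule ell2_eqI)
      fix v
      have "coord (S (ket w)) v = cnj (cinner (T (ket v)) (ket w))"
        by (metis adj cinner_commute cinner_ket_right)
      also have "\<dots> = a v"
        using toeplitz_ket[OF assms(1), of v] by (simp add: cinner_ket_right a_def h_def)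
      also have "\<dots> = (if v \<in> V then a v else 0)"
        by (auto simp: V_def a_def intro: coord_right_mult_outside)
      finally show "coord (S (ket w)) v = coord (\<Sum>v\<in>V. cscale (a v) (ket v)) v"
        by (simp add: coord_ket_sum[OF fin])
    qed
    moreover have "w \<in> V" by (simp add: V_def)
    moreover have "a w = c"
      using coord_right_mult_append[of w h "[]"] by (simp add: a_def c_def)
    ultimately have "S (ket w) - cscale c (ket w) = (\<Sum>v\<in>V - {w}. cscale (a v) (ket v))"
      by (simp add: sum.remove[OF fin])
    also have "stable \<dots>"
    proof (intro stable_sum stable_cscale less)
      fix v assume "v \<in> V - {w}"
      then show "length v < length w" by (auto simp: V_def)
    qed
    finally show ?case by (rule stable_of_eigen_defect[OF c])
  qed
qed


section \<open>Fourier series with absolutely summable coefficients\<close>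

abbreviation circle_measure :: "real measure" where
  "circle_measure \<equiv> lebesgue_on {0..2*pi}"

definition fourier_series :: "(nat \<Rightarrow> complex) \<Rightarrow> real \<Rightarrow> complex" where
  "fourier_series a \<theta> = (\<Sum>k. a k * cis (real k * \<theta>))"

lemma fourier_series_sums:
  assumes "summable (\<lambda>k. cmod (a k))"
  shows "(\<lambda>k. a k * cis (real k * \<theta>)) sums fourier_series a \<theta>"
  unfolding fourier_series_def
  by (rule summable_sums, rule summable_norm_cancel) (simp add: norm_mult assms)

lemma continuous_fourier_series:
  assumes "summable (\<lambda>k. cmod (a k))"
  shows "continuous_on A (fourier_series a)"
proof (rule uniform_limit_theorem)
  show "uniform_limit A (\<lambda>n \<theta>. \<Sum>k<n. a k * cis (real k * \<theta>)) (fourier_series a) sequentially"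
    unfolding fourier_series_def
    by (rule Weierstrass_m_test[OF _ assms]) (simp add: norm_mult)
qed (auto intro!: always_eventually continuous_intros)

lemma integrable_circle_continuous:
  fixes f :: "real \<Rightarrow> 'b::euclidean_space"
  shows "continuous_on {0..2*pi} f \<Longrightarrow> integrable circle_measure f"
  by (rule continuous_imp_integrable_real)

lemma integral_circle_const: "(\<integral>\<theta>. c \<partial>circle_measure) = of_real (2 * pi) * c" for c :: complex
proof -
  have "integrable circle_measure (\<lambda>_. c)" by (intro integrable_circle_continuous continuous_intros)
  then have "(\<integral>\<theta>. c \<partial>circle_measure) = (2 * pi) *\<^sub>R c"
    by (subst lebesgue_integral_eq_integral) auto
  then show ?thesis by (simp only: scaleR_conv_of_real)
qed

lemma integral_circle_cis:
  "(\<integral>\<theta>. cis (real_of_int j * \<theta>) \<partial>circle_measure) = (if j = 0 then of_real (2 * pi) else 0)"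
proof (cases "j = 0")
  case False
  have "((\<lambda>\<theta>. cis (real_of_int j * \<theta>)) has_integral
      (cis (real_of_int j * (2 * pi)) / (\<i> * of_int j) - cis (real_of_int j * 0) / (\<i> * of_int j))) {0..2*pi}"
  proof (rule fundamental_theorem_of_calculus)
    fix x :: real
    have "((\<lambda>\<theta>. exp (\<i> * of_int j * \<theta>) / (\<i> * of_int j)) has_vector_derivative
        exp (\<i> * of_int j * x)) (at x within {0..2*pi})"
      using False by (auto intro!: derivative_eq_intros has_vector_derivative_real_field)
    then show "((\<lambda>\<theta>. cis (real_of_int j * \<theta>) / (\<i> * of_int j)) has_vector_derivative
        cis (real_of_int j * x)) (at x within {0..2*pi})"
      by (simp add: cis_conv_exp mult_ac)
  qed simp
  moreover have "cis (real_of_int j * (2 * pi)) = 1"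
    using cis_multiple_2pi[of "of_int j"] by (simp add: mult_ac)
  ultimately have "integral {0..2*pi} (\<lambda>\<theta>. cis (real_of_int j * \<theta>)) = 0"
    by (simp add: integral_unique)
  then show ?thesis using False
    by (subst lebesgue_integral_eq_integral)
       (auto intro!: integrable_circle_continuous continuous_intros)
next
  case True
  then have "(\<lambda>\<theta>. cis (real_of_int j * \<theta>)) = (\<lambda>_. 1)" by simp
  then show ?thesis using True by (simp only: integral_circle_const) simp
qed

lemma integral_fourier_series_mult:
  fixes a :: "nat \<Rightarrow> complex" and h :: "real \<Rightarrow> complex"
  assumes a: "summable (\<lambda>k. cmod (a k))" and h: "integrable circle_measure h"
  shows "(\<lambda>k. a k * (\<integral>\<theta>. cis (real k * \<theta>) * h \<theta> \<partial>circle_measure)) sums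
    (\<integral>\<theta>. fourier_series a \<theta> * h \<theta> \<partial>circle_measure)"
proof -
  let ?f = "\<lambda>(k::nat) (\<theta>::real). a k * (cis (real k * \<theta>) * h \<theta>)"
  have cish: "integrable circle_measure (\<lambda>\<theta>. cis (real k * \<theta>) * h \<theta>)" for k
  proof (rule Bochner_Integration.integrable_bound[OF h])
    have "(\<lambda>\<theta>. cis (real k * \<theta>)) \<in> borel_measurable circle_measure"
      by (rule borel_measurable_integrable, rule integrable_circle_continuous) (intro continuous_intros)
    then show "(\<lambda>\<theta>. cis (real k * \<theta>) * h \<theta>) \<in> borel_measurable circle_measure"
      using borel_measurable_integrable[OF h] by (rule borel_measurable_times)
  qed (simp add: norm_mult)
  have "(\<lambda>k. \<integral>\<theta>. ?f k \<theta> \<partial>circle_measure) sums (\<integral>\<theta>. (\<Sum>k. ?f k \<theta>) \<partial>circle_measure)"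
  proof (rule sums_integral)
    show "integrable circle_measure (?f k)" for k
      by (intro integrable_mult_right cish)
    show "AE \<theta> in circle_measure. summable (\<lambda>k. norm (?f k \<theta>))"
      using summable_mult2[OF a] by (simp add: norm_mult)
    show "summable (\<lambda>k. \<integral>\<theta>. norm (?f k \<theta>) \<partial>circle_measure)"
      using summable_mult2[OF a] by (simp add: norm_mult)
  qed
  moreover have "(\<Sum>k. ?f k \<theta>) = fourier_series a \<theta> * h \<theta>" for \<theta>
    using sums_unique[OF sums_mult2[OF fourier_series_sums[OF a, of \<theta>], of "h \<theta>"]]
    by (simp add: mult_ac)
  ultimately show ?thesis by simp
qed

lemma integral_cis_fourier_series:
  fixes a :: "nat \<Rightarrow> complex"
  assumes a: "summable (\<lambda>k. cmod (a k))"
  shows "(\<integral>\<theta>. cis (real_of_int j * \<theta>) * fourier_series a \<theta> \<partial>circle_measure) =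
    (if j \<le> 0 then of_real (2 * pi) * a (nat (- j)) else 0)"
proof -
  have "(\<lambda>k. a k * (\<integral>\<theta>. cis (real k * \<theta>) * cis (real_of_int j * \<theta>) \<partial>circle_measure)) sums
    (\<integral>\<theta>. fourier_series a \<theta> * cis (real_of_int j * \<theta>) \<partial>circle_measure)"
    by (intro integral_fourier_series_mult a integrable_circle_continuous continuous_intros)
  moreover have "cis (real k * \<theta>) * cis (real_of_int j * \<theta>) = cis (real_of_int (int k + j) * \<theta>)" for k \<theta>
    by (simp add: cis_mult algebra_simps)
  ultimately have *: "(\<lambda>k. a k * (if int k + j = 0 then of_real (2 * pi) else 0)) sums
    (\<integral>\<theta>. cis (real_of_int j * \<theta>) * fourier_series a \<theta> \<partial>circle_measure)"
    by (simp only: integral_circle_cis mult.commute[of "fourier_series a _"])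
  have "(\<lambda>k. a k * (if int k + j = 0 then of_real (2 * pi) else 0)) sums
      (\<Sum>k\<in>(if j \<le> 0 then {nat (- j)} else {}). a k * (if int k + j = 0 then of_real (2 * pi) else 0))"
    by (rule sums_finite) (auto split: if_splits)
  from sums_unique2[OF * this] show ?thesis by simp
qed

lemma integral_cis_cnj_fourier_series:
  fixes a :: "nat \<Rightarrow> complex"
  assumes a: "summable (\<lambda>k. cmod (a k))"
  shows "(\<integral>\<theta>. cis (real_of_int j * \<theta>) * cnj (fourier_series a \<theta>) \<partial>circle_measure) =
    (if 0 \<le> j then of_real (2 * pi) * cnj (a (nat j)) else 0)"
proof -
  have "(\<integral>\<theta>. cis (real_of_int j * \<theta>) * cnj (fourier_series a \<theta>) \<partial>circle_measure) =
    (\<integral>\<theta>. cnj (cis (real_of_int (- j) * \<theta>) * fourier_series a \<theta>) \<partial>circle_measure)"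
    by (simp add: cis_cnj)
  also have "\<dots> = cnj (\<integral>\<theta>. cis (real_of_int (- j) * \<theta>) * fourier_series a \<theta> \<partial>circle_measure)"
    by (rule Bochner_Integration.integral_cnj)
  also have "\<dots> = (if 0 \<le> j then of_real (2 * pi) * cnj (a (nat j)) else 0)"
    by (simp only: integral_cis_fourier_series[OF a]) simp
  finally show ?thesis .
qed

lemma parseval_fourier_series:
  fixes a :: "nat \<Rightarrow> complex"
  assumes a: "summable (\<lambda>k. cmod (a k))"
  shows "(\<lambda>k. (cmod (a k))\<^sup>2) sums
    ((\<integral>\<theta>. (cmod (fourier_series a \<theta>))\<^sup>2 \<partial>circle_measure) / (2 * pi))"
proof -
  let ?I = "\<integral>\<theta>. (cmod (fourier_series a \<theta>))\<^sup>2 \<partial>circle_measure"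
  have "(\<lambda>k. a k * (\<integral>\<theta>. cis (real k * \<theta>) * cnj (fourier_series a \<theta>) \<partial>circle_measure)) sums
    (\<integral>\<theta>. fourier_series a \<theta> * cnj (fourier_series a \<theta>) \<partial>circle_measure)"
    by (intro integral_fourier_series_mult a integrable_circle_continuous continuous_intros
        continuous_fourier_series)
  moreover have "(\<integral>\<theta>. fourier_series a \<theta> * cnj (fourier_series a \<theta>) \<partial>circle_measure) = of_real ?I"
    unfolding complex_norm_square[symmetric] integral_complex_of_real ..
  moreover have "a k * (\<integral>\<theta>. cis (real k * \<theta>) * cnj (fourier_series a \<theta>) \<partial>circle_measure)
      = of_real (2 * pi * (cmod (a k))\<^sup>2)" for k
    using integral_cis_cnj_fourier_series[OF a, of "int k"]
    unfolding of_real_mult complex_norm_square by simp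
  ultimately have "(\<lambda>k. 2 * pi * (cmod (a k))\<^sup>2) sums ?I"
    by (simp only: sums_of_real_iff)
  from sums_divide[OF this, of "2 * pi"] show ?thesis by simp
qed


section \<open>Power series in a contraction\<close>

lemma op_pow_apply: "op_pow T k f = (blinfun_apply T ^^ k) f"
  by (induction k) (simp_all add: op_pow_def)

lemma op_pow_B_ell2: "T \<in> B_ell2 \<Longrightarrow> op_pow T k \<in> B_ell2"
  by (induction k) (auto simp: op_pow_def B_ell2_id intro: B_ell2_compose)

lemma norm_op_pow: "norm T \<le> 1 \<Longrightarrow> norm (op_pow T k) \<le> 1"
proof (induction k)
  case (Suc k)
  have "norm (op_pow T (Suc k)) \<le> norm T * norm (op_pow T k)"
    using norm_blinfun_compose[of T "op_pow T k"] by (simp add: op_pow_def)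
  also have "\<dots> \<le> 1 * 1" using Suc by (intro mult_mono) auto
  finally show ?case by simp
qed (simp add: op_pow_def norm_blinfun_bound)

definition op_series :: "(nat \<Rightarrow> complex) \<Rightarrow> 'a op \<Rightarrow> 'a op" where
  "op_series a T = (\<Sum>k. scalar_op (a k) o\<^sub>L op_pow T k)"

lemma norm_scalar_op_le: "norm (scalar_op c) \<le> cmod c"
  by (rule norm_blinfun_bound) (simp_all add: norm_cscale)

lemma summable_op_series:
  fixes T :: "'a op"
  assumes "summable (\<lambda>k. cmod (a k))" "norm T \<le> 1"
  shows "summable (\<lambda>k. scalar_op (a k) o\<^sub>L op_pow T k)"
proof (rule summable_comparison_test'[OF assms(1)])
  fix k
  have "norm (scalar_op (a k) o\<^sub>L op_pow T k) \<le> norm (scalar_op (a k) :: 'a op) * norm (op_pow T k)"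
    by (rule norm_blinfun_compose)
  also have "\<dots> \<le> cmod (a k) * 1"
    by (intro mult_mono norm_scalar_op_le norm_op_pow assms) auto
  finally show "norm (scalar_op (a k) o\<^sub>L op_pow T k) \<le> cmod (a k)" by simp
qed

lemma op_series_sums:
  assumes "summable (\<lambda>k. cmod (a k))" "norm T \<le> 1"
  shows "(\<lambda>k. cscale (a k) ((blinfun_apply T ^^ k) f)) sums op_series a T f"
  using bounded_linear.sums[OF blinfun.bounded_linear_left summable_sums[OF summable_op_series[OF assms]], of f]
  by (simp add: op_series_def op_pow_apply)

section \<open>The operator Poisson kernel\<close>

text \<open>
  For \<open>\<parallel>T\<parallel> \<le> 1\<close> the density of the stable vectors forces
  \<open>S ^^ k\<close> to tend to zero strongly, and this is the form in which that property is
  used.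
\<close>

locale stable_contraction = adjoint_pair +
  assumes contraction: "norm T \<le> 1"
    and dense_stable: "closure {f. stable f} = UNIV"
begin

lemma cinner_funpow: "cinner ((blinfun_apply T ^^ k) f) g = cinner f ((S ^^ k) g)"
proof (induction k arbitrary: g)
  case (Suc k)
  show ?case using Suc[of "S g"] by (simp add: adj funpow_swap1[of S])
qed simp

definition orbit_series :: "'a ell2 \<Rightarrow> real \<Rightarrow> 'a ell2" where
  "orbit_series f \<theta> = (\<Sum>k. cscale (cis (real k * \<theta>)) ((S ^^ k) f))"

lemma orbit_series_sums:
  "stable f \<Longrightarrow> (\<lambda>k. cscale (cis (real k * \<theta>)) ((S ^^ k) f)) sums orbit_series f \<theta>"
  unfolding orbit_series_def stable_def
  by (rule summable_sums, rule summable_norm_cancel) (simp add: norm_cscale)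

lemma orbit_series_add:
  "stable f \<Longrightarrow> stable g \<Longrightarrow> orbit_series (f + g) \<theta> = orbit_series f \<theta> + orbit_series g \<theta>"
  using sums_add[OF orbit_series_sums[of f \<theta>] orbit_series_sums[of g \<theta>]]
  by (simp add: orbit_series_def Spow_add cscale.add_right sums_iff)

lemma orbit_series_cscale:
  "stable f \<Longrightarrow> orbit_series (cscale c f) \<theta> = cscale c (orbit_series f \<theta>)"
  using bounded_linear.sums[OF cscale.bounded_linear_right orbit_series_sums[of f \<theta>], of c]
  by (simp add: orbit_series_def Spow_cscale cscale_cscale mult.commute sums_iff)

text \<open>
  Dropping the constant term of the orbit series is the same as applying \<open>S\<close> and
  rotating. This is what links the contractivity of \<open>T\<close> to the positivity of the kernel
  below.
\<close>

lemma orbit_series_step: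
  assumes "stable f"
  shows "orbit_series f \<theta> - f = cscale (cis \<theta>) (S (orbit_series f \<theta>))"
proof -
  let ?F = "\<lambda>k. cscale (cis (real k * \<theta>)) ((S ^^ k) f)"
  have "(\<lambda>k. ?F (Suc k)) sums (orbit_series f \<theta> - ?F 0)"
    using orbit_series_sums[OF assms] by (subst sums_Suc_iff) auto
  moreover have "?F (Suc k) = cscale (cis \<theta>) (S (?F k))" for k
    by (simp add: S_cscale cscale_cscale cis_mult algebra_simps)
  moreover have "(\<lambda>k. cscale (cis \<theta>) (S (?F k))) sums cscale (cis \<theta>) (S (orbit_series f \<theta>))"
    by (intro bounded_linear.sums[OF cscale.bounded_linear_right] S.sums orbit_series_sums assms)
  ultimately show ?thesis by (simp add: sums_iff)
qed

text \<open>
  The matrix coefficient \<open>\<langle>P(\<theta>) f, g\<rangle>\<close> of the operator Poisson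
  kernel on the unit circle: with \<open>z = cis \<theta>\<close> it is \<open>\<Sum>k\<ge>0.
  z\<^sup>k \<langle>S\<^sup>k f, g\<rangle>\<close> plus \<open>\<Sum>k\<ge>1. z\<^sup>-\<^sup>k
  \<langle>f, S\<^sup>k g\<rangle>\<close>. The subtracted term compensates for the summand \<open>k
  = 0\<close> being counted in both orbit series.
\<close>

definition poisson :: "'a ell2 \<Rightarrow> 'a ell2 \<Rightarrow> real \<Rightarrow> complex" where
  "poisson f g \<theta> = cinner (orbit_series f \<theta>) g + cinner f (orbit_series g \<theta>) - cinner f g"

lemma poisson_commute: "poisson g f \<theta> = cnj (poisson f g \<theta>)"
  by (simp add: poisson_def cinner_commute[symmetric])

text \<open>
  With \<open>F\<close> the orbit series of \<open>f\<close>, the kernel is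
  \<open>\<parallel>F\<parallel>\<^sup>2 - \<parallel>F - f\<parallel>\<^sup>2\<close>, and \<open>F
  - f\<close> is a rotation of \<open>S F\<close>, which is no longer than \<open>F\<close>.
\<close>

lemma poisson_nonneg:
  assumes "stable f"
  shows "0 \<le> Re (poisson f f \<theta>)"
proof -
  let ?F = "orbit_series f \<theta>"
  have "norm (?F - f) \<le> norm T * norm ?F"
    using norm_S_le[of ?F] by (simp add: orbit_series_step[OF assms] norm_cscale)
  also have "\<dots> \<le> norm ?F" using contraction by (simp add: mult_left_le_one_le)
  finally have "(norm (?F - f))\<^sup>2 \<le> (norm ?F)\<^sup>2" by (intro power_mono) auto
  moreover have "(norm (?F - f))\<^sup>2 = Re (cinner (?F - f) (?F - f))"
    by (simp add: Re_cinner_self)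
  moreover have "\<dots> = (norm ?F)\<^sup>2 - Re (poisson f f \<theta>)"
    by (simp add: cinner.diff_left cinner.diff_right poisson_def Re_cinner_self)
  ultimately show ?thesis by linarith
qed

text \<open>
  Positivity of the kernel at the vector \<open>c f - g\<close>, expanded.
\<close>

lemma poisson_schwarz:
  assumes f: "stable f" and g: "stable g"
  shows "2 * Re (c * poisson f g \<theta>) \<le> (cmod c)\<^sup>2 * Re (poisson f f \<theta>) + Re (poisson g g \<theta>)"
proof -
  let ?h = "cscale c f + cscale (-1) g"
  have "orbit_series ?h \<theta> = cscale c (orbit_series f \<theta>) + cscale (-1) (orbit_series g \<theta>)"
    by (simp only: orbit_series_add orbit_series_cscale stable_cscale f g)
  then have "poisson ?h ?h \<theta> = c * cnj c * poisson f f \<theta> - c * poisson f g \<theta>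
      - cnj c * poisson g f \<theta> + poisson g g \<theta>"
    by (simp add: poisson_def cinner_add_left cinner_add_right cinner_cscale_left
        cinner_cscale_right algebra_simps)
  then have "poisson ?h ?h \<theta> = of_real ((cmod c)\<^sup>2) * poisson f f \<theta> - 
      (c * poisson f g \<theta> + cnj (c * poisson f g \<theta>)) + poisson g g \<theta>"
    unfolding complex_norm_square[symmetric] poisson_commute[of g f] by simp
  then have "Re (poisson ?h ?h \<theta>) = (cmod c)\<^sup>2 * Re (poisson f f \<theta>) - 2 * Re (c * poisson f g \<theta>)
      + Re (poisson g g \<theta>)"
    by (simp only: complex_add_cnj plus_complex.sel minus_complex.sel Re_complex_of_real
          times_complex.sel Im_complex_of_real cnj.sel)
  moreover have "0 \<le> Re (poisson ?h ?h \<theta>)"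
    by (intro poisson_nonneg stable_add stable_cscale f g)
  ultimately show ?thesis by linarith
qed

lemma summable_cinner_orbit:
  assumes "stable f"
  shows "summable (\<lambda>k. cmod (cinner ((S ^^ k) f) g))"
  by (rule summable_comparison_test'[OF summable_mult2[OF assms[unfolded stable_def], of "norm g"]])
     (simp add: cmod_cinner_le)

lemma poisson_fourier:
  assumes "stable f" "stable g"
  shows "poisson f g \<theta> = fourier_series (\<lambda>k. cinner ((S ^^ k) f) g) \<theta>
    + cnj (fourier_series (\<lambda>k. cinner ((S ^^ k) g) f) \<theta>) - cinner f g"
proof -
  have *: "cinner (orbit_series f \<theta>) g = fourier_series (\<lambda>k. cinner ((S ^^ k) f) g) \<theta>"
    if "stable f" for f g
    using bounded_linear.sums[OF cinner.bounded_linear_left orbit_series_sums[OF that, of \<theta>], of g]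
    by (simp add: fourier_series_def sums_iff cinner_cscale_left mult.commute)
  show ?thesis
    unfolding poisson_def *[OF assms(1)] *[OF assms(2), symmetric]
    by (simp add: cinner_commute[symmetric])
qed

lemma continuous_poisson:
  assumes "stable f" "stable g"
  shows "continuous_on A (poisson f g)"
proof -
  have "poisson f g = (\<lambda>\<theta>. fourier_series (\<lambda>k. cinner ((S ^^ k) f) g) \<theta>
    + cnj (fourier_series (\<lambda>k. cinner ((S ^^ k) g) f) \<theta>) - cinner f g)"
    using poisson_fourier[OF assms] by blast
  then show ?thesis
    by (simp only:) (intro continuous_intros continuous_fourier_series summable_cinner_orbit assms)
qed

text \<open>
  The Fourier coefficients of the kernel are the matrix coefficients of the powers of
  \<open>T\<close>, which makes the kernel a density representing power series in \<open>T\<close>.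
\<close>

lemma integral_cis_poisson:
  assumes f: "stable f" and g: "stable g"
  shows "(\<integral>\<theta>. cis (real k * \<theta>) * poisson f g \<theta> \<partial>circle_measure) =
    of_real (2 * pi) * cinner ((blinfun_apply T ^^ k) f) g"
proof -
  let ?a = "\<lambda>k. cinner ((S ^^ k) f) g" and ?b = "\<lambda>k. cinner ((S ^^ k) g) f"
  note a = summable_cinner_orbit[OF f, of g] and b = summable_cinner_orbit[OF g, of f]
  let ?e = "\<lambda>\<theta>. cis (real k * \<theta>)"
  have 1: "(\<integral>\<theta>. ?e \<theta> * fourier_series ?a \<theta> \<partial>circle_measure) =
      (if k = 0 then of_real (2 * pi) * cinner f g else 0)"
    using integral_cis_fourier_series[OF a, of "int k"] by simp
  have 2: "(\<integral>\<theta>. ?e \<theta> * cnj (fourier_series ?b \<theta>) \<partial>circle_measure) =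
      of_real (2 * pi) * cinner f ((S ^^ k) g)"
    using integral_cis_cnj_fourier_series[OF b, of "int k"] by (simp add: cinner_commute[symmetric])
  have 3: "(\<integral>\<theta>. ?e \<theta> * cinner f g \<partial>circle_measure) =
      (if k = 0 then of_real (2 * pi) * cinner f g else 0)"
    using integral_circle_cis[of "int k"] by simp
  have i1: "integrable circle_measure (\<lambda>\<theta>. ?e \<theta> * fourier_series ?a \<theta>)"
    by (intro integrable_circle_continuous continuous_intros continuous_fourier_series a)
  have i2: "integrable circle_measure (\<lambda>\<theta>. ?e \<theta> * cnj (fourier_series ?b \<theta>))"
    by (intro integrable_circle_continuous continuous_intros continuous_fourier_series b)
  have i3: "integrable circle_measure (\<lambda>\<theta>. ?e \<theta> * cinner f g)"
    by (intro integrable_circle_continuous continuous_intros)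
  have "(\<integral>\<theta>. ?e \<theta> * poisson f g \<theta> \<partial>circle_measure) = 
    (\<integral>\<theta>. ?e \<theta> * fourier_series ?a \<theta> + ?e \<theta> * cnj (fourier_series ?b \<theta>) - ?e \<theta> * cinner f g \<partial>circle_measure)"
    by (simp add: poisson_fourier[OF f g] algebra_simps)
  also have "\<dots> = of_real (2 * pi) * cinner f ((S ^^ k) g)"
    using Bochner_Integration.integral_diff[OF Bochner_Integration.integrable_add[OF i1 i2] i3]
      Bochner_Integration.integral_add[OF i1 i2]
    unfolding 1 2 3 by simp
  finally show ?thesis by (simp only: cinner_funpow)
qed

lemma integral_poisson_self:
  assumes "stable f"
  shows "(\<integral>\<theta>. Re (poisson f f \<theta>) \<partial>circle_measure) = 2 * pi * (norm f)\<^sup>2"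
proof -
  have "integrable circle_measure (poisson f f)"
    by (intro integrable_circle_continuous continuous_poisson assms)
  then have "(\<integral>\<theta>. Re (poisson f f \<theta>) \<partial>circle_measure) = Re (\<integral>\<theta>. poisson f f \<theta> \<partial>circle_measure)"
    by (rule integral_Re)
  also have "\<dots> = 2 * pi * (norm f)\<^sup>2"
    using integral_cis_poisson[OF assms assms, of 0] by (simp add: cinner_norm_self)
  finally show ?thesis .
qed

text \<open>
  The Schwarz inequality for the positive kernel, integrated. The factor \<open>t\<close> equals
  \<open>\<parallel>g\<parallel> / \<parallel>f\<parallel>\<close>, which balances the two terms and
  gives the product of the norms.
\<close>

lemma integral_poisson_bound:
  assumes f: "stable f" and g: "stable g"
  shows "(\<integral>\<theta>. cmod (poisson f g \<theta>) \<partial>circle_measure) \<le> 2 * pi * (norm f * norm g)"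
proof (cases "f = 0 \<or> g = 0")
  case True
  then have "poisson f g \<theta> = 0" for \<theta>
    by (auto simp: poisson_def orbit_series_def Spow_zero cscale.zero_right cinner.zero_left
         cinner.zero_right)
  then show ?thesis by simp
next
  case False
  define t where "t = norm g / norm f"
  have t: "0 < t" using False by (simp add: t_def)
  have point: "2 * t * cmod (poisson f g \<theta>) \<le> t\<^sup>2 * Re (poisson f f \<theta>) + Re (poisson g g \<theta>)" for \<theta>
  proof -
    define z where "z = poisson f g \<theta>"
    define c where "c = of_real t * cnj (sgn z)"
    have "cnj (sgn z) * z = of_real (cmod z)"
    proof (cases "z = 0")
      case False
      have "z * cnj z = of_real (cmod z) * of_real (cmod z)"
        by (simp add: complex_norm_square[symmetric] power2_eq_square)
      then show ?thesis using False by (simp add: sgn_eq mult.commute)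
    qed simp
    then have "c * z = of_real (t * cmod z)" by (simp add: c_def mult.assoc)
    moreover have "(cmod c)\<^sup>2 * Re (poisson f f \<theta>) \<le> t\<^sup>2 * Re (poisson f f \<theta>)"
      using t by (intro mult_right_mono poisson_nonneg f power_mono)
        (auto simp: c_def norm_mult norm_sgn)
    ultimately show ?thesis
      using poisson_schwarz[OF f g, of c \<theta>] unfolding z_def[symmetric] by simp
  qed
  have i: "integrable circle_measure (\<lambda>\<theta>. t\<^sup>2 * Re (poisson f f \<theta>))"
     "integrable circle_measure (\<lambda>\<theta>. Re (poisson g g \<theta>))"
     "integrable circle_measure (\<lambda>\<theta>. 2 * t * cmod (poisson f g \<theta>))"
    by (intro integrable_circle_continuous continuous_intros continuous_poisson f g)+
  have "2 * t * (\<integral>\<theta>. cmod (poisson f g \<theta>) \<partial>circle_measure) =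
      (\<integral>\<theta>. 2 * t * cmod (poisson f g \<theta>) \<partial>circle_measure)" by simp
  also have "\<dots> \<le> (\<integral>\<theta>. t\<^sup>2 * Re (poisson f f \<theta>) + Re (poisson g g \<theta>) \<partial>circle_measure)"
    by (intro integral_mono Bochner_Integration.integrable_add i point)
  also have "\<dots> = t\<^sup>2 * (2 * pi * (norm f)\<^sup>2) + 2 * pi * (norm g)\<^sup>2"
    unfolding Bochner_Integration.integral_add[OF i(1,2)] by (simp add: integral_poisson_self f g)
  also have "\<dots> = 2 * t * (2 * pi * (norm f * norm g))"
    using False by (simp add: t_def power2_eq_square field_simps)
  finally show ?thesis using t by simp
qed

lemma cinner_op_series:
  assumes a: "summable (\<lambda>k. cmod (a k))" and f: "stable f" and g: "stable g"
  shows "(\<integral>\<theta>. fourier_series a \<theta> * poisson f g \<theta> \<partial>circle_measure) =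
    of_real (2 * pi) * cinner (op_series a T f) g"
proof -
  have "(\<lambda>k. cinner (cscale (a k) ((blinfun_apply T ^^ k) f)) g) sums cinner (op_series a T f) g"
    by (intro bounded_linear.sums[OF cinner.bounded_linear_left] op_series_sums a contraction)
  from sums_mult[OF this, of "of_real (2 * pi)"]
  have "(\<lambda>k. a k * (of_real (2 * pi) * cinner ((blinfun_apply T ^^ k) f) g)) sums
     (of_real (2 * pi) * cinner (op_series a T f) g)"
    by (simp only: cinner_cscale_left mult.left_commute)
  moreover have "(\<lambda>k. a k * (of_real (2 * pi) * cinner ((blinfun_apply T ^^ k) f) g)) sums
     (\<integral>\<theta>. fourier_series a \<theta> * poisson f g \<theta> \<partial>circle_measure)"
    unfolding integral_cis_poisson[OF f g, symmetric]
    by (intro integral_fourier_series_mult a integrable_circle_continuous continuous_poisson f g)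
  ultimately show ?thesis by (rule sums_unique2[symmetric])
qed

text \<open>
  Writing \<open>y\<close> for \<open>a(T) f\<close> and \<open>I\<close> for the normalised
  integral on the right, the Schwarz inequality under the integral gives \<open>2 Re \<langle>y,
  g\<rangle> \<le> I + \<parallel>g\<parallel>\<^sup>2\<close> for stable \<open>g\<close>, hence
  for all \<open>g\<close> by density. The choice \<open>g = y\<close> yields
  \<open>\<parallel>y\<parallel>\<^sup>2 \<le> I\<close>. Bounding the integrand in two different
  ways gives von Neumann's inequality and the square-summability estimate behind strong convergence.
\<close>

lemma norm_op_series_le_integral:
  assumes a: "summable (\<lambda>k. cmod (a k))" and f: "stable f"
  shows "2 * pi * (norm (op_series a T f))\<^sup>2 \<le>
    (\<integral>\<theta>. (cmod (fourier_series a \<theta>))\<^sup>2 * Re (poisson f f \<theta>) \<partial>circle_measure)" (is "_ \<le> ?I")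
proof -
  let ?y = "op_series a T f"
  have "2 * (2 * pi) * Re (cinner ?y g) \<le> ?I + 2 * pi * (norm g)\<^sup>2" if g: "stable g" for g
  proof -
    have i: "integrable circle_measure (\<lambda>\<theta>. (cmod (fourier_series a \<theta>))\<^sup>2 * Re (poisson f f \<theta>))"
      "integrable circle_measure (\<lambda>\<theta>. Re (poisson g g \<theta>))"
      "integrable circle_measure (\<lambda>\<theta>. fourier_series a \<theta> * poisson f g \<theta>)"
      by (intro integrable_circle_continuous continuous_intros continuous_poisson f g
          continuous_fourier_series a)+
    have "2 * (2 * pi) * Re (cinner ?y g) =
        2 * Re (\<integral>\<theta>. fourier_series a \<theta> * poisson f g \<theta> \<partial>circle_measure)"
      by (simp add: cinner_op_series[OF a f g])
    also have "\<dots> = (\<integral>\<theta>. 2 * Re (fourier_series a \<theta> * poisson f g \<theta>) \<partial>circle_measure)"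
      by (simp only: integral_Re[OF i(3)] integral_mult_right_zero)
    also have "\<dots> \<le> (\<integral>\<theta>. (cmod (fourier_series a \<theta>))\<^sup>2 * Re (poisson f f \<theta>)
        + Re (poisson g g \<theta>) \<partial>circle_measure)"
      by (intro integral_mono Bochner_Integration.integrable_add integrable_mult_right integrable_Re
          i poisson_schwarz f g)
    also have "\<dots> = ?I + 2 * pi * (norm g)\<^sup>2"
      unfolding Bochner_Integration.integral_add[OF i(1,2)] by (simp add: integral_poisson_self g)
    finally show ?thesis .
  qed
  then have "{g. stable g} \<subseteq> {g. 2 * (2 * pi) * Re (cinner ?y g) \<le> ?I + 2 * pi * (norm g)\<^sup>2}"
    by blast
  moreover have "closed {g. 2 * (2 * pi) * Re (cinner ?y g) \<le> ?I + 2 * pi * (norm g)\<^sup>2}"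
    by (intro closed_Collect_le continuous_intros cinner.continuous_on)
  ultimately have "UNIV \<subseteq> {g. 2 * (2 * pi) * Re (cinner ?y g) \<le> ?I + 2 * pi * (norm g)\<^sup>2}"
    unfolding dense_stable[symmetric] by (rule closure_minimal)
  then have "2 * (2 * pi) * Re (cinner ?y ?y) \<le> ?I + 2 * pi * (norm ?y)\<^sup>2" by blast
  then show ?thesis by (simp add: Re_cinner_self)
qed

end


section \<open>Taylor coefficients of bounded analytic functions\<close>

abbreviation abel_coeff :: "(complex \<Rightarrow> complex) \<Rightarrow> real \<Rightarrow> nat \<Rightarrow> complex" where
  "abel_coeff u r k \<equiv> of_real (r ^ k) * taylor_coeff u k"

lemma Abel_sum_op_eq: "Abel_sum_op u T r = op_series (abel_coeff u r) T"
  by (simp add: Abel_sum_op_def op_series_def)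

lemma Hinf_holomorphic: "u \<in> Hinf \<Longrightarrow> u holomorphic_on ball 0 1"
  by (simp add: Hinf_def)

lemma taylor_sums:
  assumes "u \<in> Hinf" "cmod z < 1"
  shows "(\<lambda>k. taylor_coeff u k * z ^ k) sums u z"
  using holomorphic_power_series[OF Hinf_holomorphic[OF assms(1)], of z] assms(2)
  by (simp add: taylor_coeff_def)

lemma summable_abel_coeff:
  assumes u: "u \<in> Hinf" and r: "0 \<le> r" "r < 1"
  shows "summable (\<lambda>k. cmod (abel_coeff u r k))"
proof -
  have "cmod (of_real ((1 + r) / 2)) < 1" using r by (simp only: norm_of_real) simp
  from sums_summable[OF taylor_sums[OF u this]]
  have "summable (\<lambda>k. norm (taylor_coeff u k * complex_of_real r ^ k))"
    by (rule powser_insidea) (use r in \<open>simp only: norm_of_real; simp\<close>)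
  then show ?thesis by (simp add: norm_mult mult.commute)
qed

lemma Hinf_norm_ge:
  assumes "u \<in> Hinf" "cmod z < 1"
  shows "cmod (u z) \<le> Hinf_norm u"
proof -
  obtain B where "\<forall>w\<in>u ` ball 0 1. cmod w \<le> B"
    using assms(1) unfolding Hinf_def bounded_iff by blast
  then have "\<And>z. z \<in> ball 0 1 \<Longrightarrow> cmod (u z) \<le> B" by blast
  then have "bdd_above ((\<lambda>z. cmod (u z)) ` ball 0 1)" by (rule bdd_aboveI2)
  then show ?thesis
    unfolding Hinf_norm_def by (rule cSUP_upper2[where x = z]) (use assms(2) in auto)
qed

lemma fourier_series_abel:
  assumes "u \<in> Hinf" "0 \<le> r" "r < 1"
  shows "fourier_series (abel_coeff u r) \<theta> = u (of_real r * cis \<theta>)"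
proof -
  have "(\<lambda>k. taylor_coeff u k * (of_real r * cis \<theta>) ^ k) sums u (of_real r * cis \<theta>)"
    by (rule taylor_sums) (use assms in \<open>simp_all add: norm_mult\<close>)
  moreover have "taylor_coeff u k * (of_real r * cis \<theta>) ^ k = abel_coeff u r k * cis (real k * \<theta>)" for k
    by (simp add: power_mult_distrib Complex.DeMoivre)
  ultimately show ?thesis by (simp only: fourier_series_def sums_iff)
qed

lemma cmod_fourier_series_abel_le:
  assumes "u \<in> Hinf" "0 \<le> r" "r < 1"
  shows "cmod (fourier_series (abel_coeff u r) \<theta>) \<le> Hinf_norm u"
  unfolding fourier_series_abel[OF assms]
  by (rule Hinf_norm_ge) (use assms in \<open>simp_all add: norm_mult\<close>)

lemma Hinf_norm_nonneg: "u \<in> Hinf \<Longrightarrow> 0 \<le> Hinf_norm u"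
  using order_trans[OF norm_ge_zero Hinf_norm_ge[of u 0]] by simp

text \<open>
  Parseval on the circle of radius \<open>r\<close> bounds each partial sum by the square of the
  supremum norm, and \<open>r\<close> may tend to one.
\<close>

lemma summable_taylor_coeff_squares:
  assumes u: "u \<in> Hinf"
  shows "summable (\<lambda>k. (cmod (taylor_coeff u k))\<^sup>2)"
proof (rule summableI_nonneg_bounded)
  let ?M = "Hinf_norm u"
  fix N
  have le: "(\<Sum>k<N. (cmod (abel_coeff u r k))\<^sup>2) \<le> ?M\<^sup>2" if r: "0 \<le> r" "r < 1" for r
  proof -
    note a = summable_abel_coeff[OF u r]
    have "(\<Sum>k<N. (cmod (abel_coeff u r k))\<^sup>2) \<le> (\<Sum>k. (cmod (abel_coeff u r k))\<^sup>2)"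
      by (rule sum_le_suminf) (use parseval_fourier_series[OF a] in \<open>auto simp: sums_iff\<close>)
    also have "\<dots> = (\<integral>\<theta>. (cmod (fourier_series (abel_coeff u r) \<theta>))\<^sup>2 \<partial>circle_measure) / (2 * pi)"
      using parseval_fourier_series[OF a] by (simp add: sums_iff)
    also have "\<dots> \<le> (\<integral>\<theta>. ?M\<^sup>2 \<partial>circle_measure) / (2 * pi)"
      by (intro divide_right_mono integral_mono integrable_circle_continuous continuous_intros
          continuous_fourier_series a power_mono cmod_fourier_series_abel_le u r) auto
    also have "(\<integral>\<theta>. ?M\<^sup>2 \<partial>circle_measure) = 2 * pi * ?M\<^sup>2"
      by (subst lebesgue_integral_eq_integral) (auto intro!: integrable_circle_continuous)
    finally show ?thesis by simp
  qed
  have "((\<lambda>r. \<Sum>k<N. (cmod (abel_coeff u r k))\<^sup>2) \<longlongrightarrow>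
      (\<Sum>k<N. (cmod (abel_coeff u 1 k))\<^sup>2)) (at_left 1)"
    by (intro tendsto_intros)
  moreover have "\<forall>\<^sub>F r in at_left 1. (\<Sum>k<N. (cmod (abel_coeff u r k))\<^sup>2) \<le> ?M\<^sup>2"
  proof (rule eventually_mono[OF eventually_at_left_real])
    fix r :: real assume "r \<in> {0<..<1}"
    then show "(\<Sum>k<N. (cmod (abel_coeff u r k))\<^sup>2) \<le> ?M\<^sup>2" by (intro le) auto
  qed simp
  ultimately show "(\<Sum>k<N. (cmod (taylor_coeff u k))\<^sup>2) \<le> ?M\<^sup>2"
    using tendsto_upperbound[of _ _ "at_left (1::real)" "?M\<^sup>2"] by auto
qed auto

lemma taylor_coeff_add:
  "u \<in> Hinf \<Longrightarrow> v \<in> Hinf \<Longrightarrow> taylor_coeff (\<lambda>z. u z + v z) k = taylor_coeff u k + taylor_coeff v k"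
  unfolding taylor_coeff_def
  by (subst higher_deriv_add[where S = "ball 0 1"]) (auto dest: Hinf_holomorphic simp: add_divide_distrib)

lemma taylor_coeff_cmult:
  "u \<in> Hinf \<Longrightarrow> taylor_coeff (\<lambda>z. c * u z) k = c * taylor_coeff u k"
  unfolding taylor_coeff_def
  by (subst higher_deriv_cmult[where A = "ball 0 1"]) (auto dest: Hinf_holomorphic)

lemma taylor_coeff_mult:
  assumes "u \<in> Hinf" "v \<in> Hinf"
  shows "taylor_coeff (\<lambda>z. u z * v z) k = (\<Sum>i\<le>k. taylor_coeff u i * taylor_coeff v (k - i))"
proof -
  have "taylor_coeff (\<lambda>z. u z * v z) k =
     (\<Sum>i\<le>k. of_nat (k choose i) * (deriv ^^ i) u 0 * (deriv ^^ (k - i)) v 0 / fact k)"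
    unfolding taylor_coeff_def
    by (subst higher_deriv_mult[where S = "ball 0 1"])
       (use assms in \<open>auto dest: Hinf_holomorphic simp: sum_divide_distrib atLeast0AtMost\<close>)
  also have "\<dots> = (\<Sum>i\<le>k. taylor_coeff u i * taylor_coeff v (k - i))"
    by (rule sum.cong[OF refl]) (simp add: taylor_coeff_def binomial_fact field_simps)
  finally show ?thesis .
qed

lemma Hinf_add: "u \<in> Hinf \<Longrightarrow> v \<in> Hinf \<Longrightarrow> (\<lambda>z. u z + v z) \<in> Hinf"
  by (auto simp: Hinf_def intro!: holomorphic_intros bounded_plus_comp)

lemma Hinf_cmult: "u \<in> Hinf \<Longrightarrow> (\<lambda>z. c * u z) \<in> Hinf"
  by (auto simp: Hinf_def bounded_iff norm_mult intro!: holomorphic_intros)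
     (metis mult_left_mono norm_ge_zero)

lemma Hinf_mult:
  assumes "u \<in> Hinf" "v \<in> Hinf"
  shows "(\<lambda>z. u z * v z) \<in> Hinf"
proof -
  have "cmod (u z * v z) \<le> Hinf_norm u * Hinf_norm v" if "cmod z < 1" for z
    unfolding norm_mult using assms that
    by (intro mult_mono Hinf_norm_ge Hinf_norm_nonneg) auto
  then show ?thesis
    using assms unfolding Hinf_def bounded_iff
    by (auto intro!: holomorphic_intros exI[of _ "Hinf_norm u * Hinf_norm v"])
qed

lemma Hinf_const: "(\<lambda>z. c) \<in> Hinf"
  by (auto simp: Hinf_def bounded_iff)

lemma Hinf_ident: "(\<lambda>z. z) \<in> Hinf"
  by (auto simp: Hinf_def bounded_iff intro!: exI[of _ 1])

section \<open>Algebra of power series in a contraction\<close>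

lemma funpow_cscale:
  fixes T :: "'a op"
  assumes "T \<in> B_ell2"
  shows "(blinfun_apply T ^^ k) (cscale c f) = cscale c ((blinfun_apply T ^^ k) f)"
  using op_pow_B_ell2[OF assms, of k] by (simp add: B_ell2_def op_pow_apply)

lemma op_series_B_ell2:
  assumes "T \<in> B_ell2" "summable (\<lambda>k. cmod (a k))" "norm T \<le> 1"
  shows "op_series a T \<in> B_ell2"
proof -
  have "op_series a T (cscale c f) = cscale c (op_series a T f)" for c f
  proof -
    have "(\<lambda>k. cscale (a k) ((blinfun_apply T ^^ k) (cscale c f))) sums
        cscale c (op_series a T f)"
      using bounded_linear.sums[OF cscale.bounded_linear_right op_series_sums[OF assms(2,3), of f], of c]
      by (simp add: funpow_cscale[OF assms(1)] cscale_cscale mult.commute)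
    then show ?thesis using op_series_sums[OF assms(2,3), of "cscale c f"] sums_unique2 by blast
  qed
  then show ?thesis by (simp add: B_ell2_def)
qed

lemma op_series_add:
  assumes "summable (\<lambda>k. cmod (a k))" "summable (\<lambda>k. cmod (b k))" "norm T \<le> 1"
  shows "op_series (\<lambda>k. a k + b k) T f = op_series a T f + op_series b T f"
proof -
  have s: "summable (\<lambda>k. cmod (a k + b k))"
    by (rule summable_comparison_test'[OF summable_add[OF assms(1,2)]]) (simp add: norm_triangle_ineq)
  have "(\<lambda>k. cscale (a k + b k) ((blinfun_apply T ^^ k) f)) sums (op_series a T f + op_series b T f)"
    using sums_add[OF op_series_sums[OF assms(1,3), of f] op_series_sums[OF assms(2,3), of f]]
    by (simp add: cscale.add_left)
  then show ?thesis using op_series_sums[OF s assms(3), of f] sums_unique2 by blast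
qed

lemma op_series_cmult:
  assumes "summable (\<lambda>k. cmod (a k))" "norm T \<le> 1"
  shows "op_series (\<lambda>k. c * a k) T f = cscale c (op_series a T f)"
proof -
  have s: "summable (\<lambda>k. cmod (c * a k))"
    using summable_mult[OF assms(1), of "cmod c"] by (simp add: norm_mult)
  have "(\<lambda>k. cscale (c * a k) ((blinfun_apply T ^^ k) f)) sums cscale c (op_series a T f)"
    using bounded_linear.sums[OF cscale.bounded_linear_right op_series_sums[OF assms, of f], of c]
    by (simp add: cscale_cscale)
  then show ?thesis using op_series_sums[OF s assms(2), of f] sums_unique2 by blast
qed

lemma op_series_finite:
  assumes "finite F" and "\<And>k. k \<notin> F \<Longrightarrow> a k = 0" and "norm T \<le> 1"
  shows "op_series a T f = (\<Sum>k\<in>F. cscale (a k) ((blinfun_apply T ^^ k) f))"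
proof -
  have "summable (\<lambda>k. cmod (a k))" by (rule summable_finite[OF assms(1)]) (simp add: assms)
  from op_series_sums[OF this assms(3), of f]
  have "(\<lambda>k. cscale (a k) ((blinfun_apply T ^^ k) f)) sums op_series a T f" .
  moreover have "(\<lambda>k. cscale (a k) ((blinfun_apply T ^^ k) f)) sums
      (\<Sum>k\<in>F. cscale (a k) ((blinfun_apply T ^^ k) f))"
    by (rule sums_finite[OF assms(1)]) (simp add: assms cscale.zero_left)
  ultimately show ?thesis by (rule sums_unique2)
qed

lemma norm_funpow_le:
  fixes T :: "'a op"
  assumes "norm T \<le> 1"
  shows "norm ((blinfun_apply T ^^ k) f) \<le> norm f"
proof -
  have "norm (op_pow T k f) \<le> norm (op_pow T k) * norm f" by (rule norm_blinfun)
  also have "\<dots> \<le> 1 * norm f" by (intro mult_right_mono norm_op_pow assms) auto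
  finally show ?thesis by (simp add: op_pow_apply)
qed

text \<open>
  The double family \<open>a i * b j\<close> times \<open>T\<^sup>i\<^sup>+\<^sup>j f\<close> is
  absolutely summable; summed by rows it gives the right side, along the antidiagonals \<open>i + j
  = n\<close> the left side.
\<close>

lemma op_series_Cauchy_product:
  fixes T :: "'a op"
  assumes T: "T \<in> B_ell2" "norm T \<le> 1"
    and a: "summable (\<lambda>k. cmod (a k))" and b: "summable (\<lambda>k. cmod (b k))"
    and c: "summable (\<lambda>k. cmod (c k))" "\<And>k. c k = (\<Sum>i\<le>k. a i * b (k - i))"
  shows "op_series c T f = op_series a T (op_series b T f)"
proof -
  let ?P = "\<lambda>k. (blinfun_apply T ^^ k)"
  define X where "X = (\<lambda>(i, j). cscale (a i * b j) (?P (i + j) f))"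
  define p where "p = (\<lambda>(i, j). cmod (a i) * cmod (b j) * norm f)"
  have "p summable_on (UNIV \<times> UNIV)"
  proof (rule summable_on_SigmaI)
    fix i :: nat
    have "((\<lambda>j. cmod (b j)) has_sum (\<Sum>j. cmod (b j))) UNIV"
      by (rule sums_nonneg_imp_has_sum) (use b in auto)
    then show "((\<lambda>j. p (i, j)) has_sum (cmod (a i) * (\<Sum>j. cmod (b j)) * norm f)) UNIV"
      unfolding p_def by (auto intro!: has_sum_cmult_left has_sum_cmult_right)
    have "(\<lambda>i. cmod (a i)) summable_on UNIV"
      using sums_nonneg_imp_has_sum[OF summable_sums[OF a]] by (auto simp: summable_on_def)
    then show "(\<lambda>i. cmod (a i) * (\<Sum>j. cmod (b j)) * norm f) summable_on UNIV"
      by (intro summable_on_cmult_left)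
  qed (auto simp: p_def)
  then have "(\<lambda>x. norm (X x)) summable_on (UNIV \<times> UNIV)"
    by (rule Infinite_Sum.abs_summable_on_comparison_test')
       (auto simp: X_def p_def norm_cscale norm_mult intro!: mult_left_mono norm_funpow_le T)
  then have "X summable_on (UNIV \<times> UNIV)" by (rule Infinite_Sum.abs_summable_summable)
  then obtain s where s: "(X has_sum s) (UNIV \<times> UNIV)" by (auto simp: summable_on_def)
  have row: "((\<lambda>j. X (i, j)) has_sum cscale (a i) (?P i (op_series b T f))) UNIV" for i
  proof (rule norm_summable_imp_has_sum)
    have "summable (\<lambda>j. cmod (a i) * norm f * cmod (b j))" by (intro summable_mult b)
    then show "summable (\<lambda>j. norm (X (i, j)))"
      by (rule summable_comparison_test') 
        (auto simp: X_def norm_cscale norm_mult mult.assoc mult.left_commute[of "norm f"]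
          mult.commute[of "norm f"] intro!: mult_left_mono norm_funpow_le T)
    have "(\<lambda>j. cscale (a i) (op_pow T i (cscale (b j) (?P j f)))) sums
        cscale (a i) (op_pow T i (op_series b T f))"
      by (intro bounded_linear.sums[OF cscale.bounded_linear_right]
          bounded_linear.sums[OF blinfun.bounded_linear_right] op_series_sums b T)
    then show "(\<lambda>j. X (i, j)) sums cscale (a i) (?P i (op_series b T f))"
      by (simp add: X_def funpow_cscale[OF T(1)] cscale_cscale op_pow_apply
          funpow_add)
  qed
  have "((\<lambda>i. cscale (a i) (?P i (op_series b T f))) has_sum s) UNIV"
    using s row by (rule has_sum_SigmaD)
  then have 1: "s = op_series a T (op_series b T f)"
    using op_series_sums[OF a T(2)] has_sum_imp_sums sums_unique2 by blast
  have "((\<lambda>(n, i). X (i, n - i)) has_sum s) (Sigma UNIV (\<lambda>n. {..n}))"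
    by (rule has_sum_reindex_bij_witness[where j = "\<lambda>(n, i). (i, n - i)" and
        i = "\<lambda>(i, j). (i + j, i)" and h = X and T = "UNIV \<times> UNIV" and s' = s, THEN iffD2])
       (use s in auto)
  then have "((\<lambda>n. \<Sum>i\<le>n. X (i, n - i)) has_sum s) UNIV"
    by (rule has_sum_SigmaD) (auto intro: has_sum_finite)
  moreover have "(\<Sum>i\<le>n. X (i, n - i)) = cscale (c n) (?P n f)" for n
    by (simp add: X_def c(2) cscale.sum_left)
  ultimately have "(\<lambda>n. cscale (c n) (?P n f)) sums s"
    by (simp add: has_sum_imp_sums)
  then have "op_series c T f = s"
    using op_series_sums[OF c(1) T(2), of f] sums_unique2 by blast
  with 1 show ?thesis by simp
qed


section \<open>Existence of the calculus\<close>

lemma at_left_1_interval: "\<forall>\<^sub>F r::real in at_left 1. 0 < r \<and> r < 1"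
  by (rule eventually_mono[OF eventually_at_left_real[of 0 1]]) auto

lemma at_left_1_eventuallyI: "(\<And>r::real. 0 < r \<Longrightarrow> r < 1 \<Longrightarrow> P r) \<Longrightarrow> \<forall>\<^sub>F r in at_left 1. P r"
  by (rule eventually_mono[OF at_left_1_interval]) auto

text \<open>
  A uniformly bounded family of operators that converges on a dense set converges strongly
  everywhere: the limits along an approximating sequence are Cauchy, and the uniform bound transfers
  their limit to the given vector.
\<close>

lemma strong_limit_of_dense:
  fixes A :: "'i \<Rightarrow> 'b::real_normed_vector \<Rightarrow>\<^sub>L 'c::banach"
  assumes F: "F \<noteq> bot" and bound: "\<forall>\<^sub>F i in F. norm (A i) \<le> M"
    and dense: "closure D = UNIV"
    and conv: "\<And>f. f \<in> D \<Longrightarrow> \<exists>y. ((\<lambda>i. A i f) \<longlongrightarrow> y) F"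
  shows "\<exists>L :: 'b \<Rightarrow>\<^sub>L 'c. norm L \<le> M \<and> (\<forall>f. ((\<lambda>i. A i f) \<longlongrightarrow> blinfun_apply L f) F)"
proof -
  have "\<exists>i. norm (A i) \<le> M" using eventually_happens[OF bound] F by auto
  then have M: "0 \<le> M" using order_trans[OF norm_ge_zero] by blast
  have le: "\<forall>\<^sub>F i in F. norm (A i f) \<le> M * norm f" for f
    using bound
  proof eventually_elim
    case (elim i)
    then show ?case using norm_blinfun[of "A i" f] mult_right_mono[OF elim, of "norm f"] by simp
  qed
  have "\<exists>y. ((\<lambda>i. A i f) \<longlongrightarrow> y) F" for f
  proof -
    have "f \<in> closure D" using dense by simp
    then obtain h where h: "\<And>n. h n \<in> D" "h \<longlonglongrightarrow> f" using closure_sequential by blast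
    obtain y where y: "\<And>n. ((\<lambda>i. A i (h n)) \<longlongrightarrow> y n) F" using conv[OF h(1)] by metis
    have yy: "dist (y n) (y m) \<le> M * dist (h n) (h m)" for n m
    proof -
      have "((\<lambda>i. A i (h n - h m)) \<longlongrightarrow> y n - y m) F"
        unfolding blinfun.diff_right by (intro tendsto_diff y)
      from Lim_norm_ubound[OF F this le] show ?thesis by (simp add: dist_norm)
    qed
    have "Cauchy y"
    proof (rule metric_CauchyI)
      fix e :: real assume e: "0 < e"
      have "Cauchy h" using h(2) by (rule LIMSEQ_imp_Cauchy)
      \<comment> \<open>The divisor is \<open>M + 1\<close> because \<open>M\<close> may be zero.\<close>
      then obtain N where N: "\<And>m n. m \<ge> N \<Longrightarrow> n \<ge> N \<Longrightarrow> dist (h m) (h n) < e / (M + 1)"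
        using metric_CauchyD[of h "e / (M + 1)"] e M by auto
      have "dist (y m) (y n) < e" if "m \<ge> N" "n \<ge> N" for m n
      proof -
        have "dist (y m) (y n) \<le> (M + 1) * dist (h m) (h n)"
          using yy[of m n] by (simp add: distrib_right add_increasing2)
        also have "\<dots> < (M + 1) * (e / (M + 1))"
          using N[OF that] M by (intro mult_strict_left_mono) auto
        finally show ?thesis using M by simp
      qed
      then show "\<exists>N. \<forall>m\<ge>N. \<forall>n\<ge>N. dist (y m) (y n) < e" by blast
    qed
    then have "convergent y" by (rule Cauchy_convergent)
    then obtain l where l: "y \<longlonglongrightarrow> l" by (auto simp: convergent_def)
    have "((\<lambda>i. A i f) \<longlongrightarrow> l) F"
    proof (rule tendstoI)
      fix e :: real assume e: "0 < e"
      have "(\<lambda>n. M * norm (f - h n) + dist (y n) l) \<longlonglongrightarrow> M * norm (f - f) + 0"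
        by (intro tendsto_intros h(2) iffD1[OF tendsto_dist_iff l])
      then have "\<forall>\<^sub>F n in sequentially. M * norm (f - h n) + dist (y n) l < e"
        using e by (intro order_tendstoD(2)) auto
      then obtain n where n: "M * norm (f - h n) + dist (y n) l < e"
        using eventually_happens[of _ sequentially] by auto
      have "\<forall>\<^sub>F i in F. dist (A i (h n)) (y n) < e - (M * norm (f - h n) + dist (y n) l)"
        using n by (intro tendstoD[OF y]) auto
      then show "\<forall>\<^sub>F i in F. dist (A i f) l < e"
        using le[of "f - h n"]
      proof eventually_elim
        case (elim i)
        have "dist (A i f) l \<le> dist (A i f) (A i (h n)) + dist (A i (h n)) (y n) + dist (y n) l"
          using dist_triangle[of "A i f" l "A i (h n)"] dist_triangle[of "A i (h n)" l "y n"] by simp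
        moreover have "dist (A i f) (A i (h n)) \<le> M * norm (f - h n)"
          using elim(2) by (simp add: dist_norm blinfun.diff_right)
        ultimately show ?case using elim(1) by simp
      qed
    qed
    then show ?thesis by blast
  qed
  then obtain L where L: "\<And>f. ((\<lambda>i. A i f) \<longlongrightarrow> L f) F" by metis
  have nL: "norm (L f) \<le> M * norm f" for f by (rule Lim_norm_ubound[OF F L le])
  have "bounded_linear L"
  proof (rule bounded_linear_intro)
    show "L (f + g) = L f + L g" for f g
      using tendsto_unique[OF F L[of "f + g"]] tendsto_add[OF L[of f] L[of g]]
      by (simp add: blinfun.add_right)
    show "L (r *\<^sub>R f) = r *\<^sub>R L f" for r f
      using tendsto_unique[OF F L[of "r *\<^sub>R f"]] tendsto_scaleR[OF tendsto_const L[of f], of r]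
      by (simp add: blinfun.scaleR_right)
    show "norm (L f) \<le> norm f * M" for f using nL[of f] by (simp add: mult.commute)
  qed
  then have ap: "blinfun_apply (Blinfun L) = L" by (rule bounded_linear_Blinfun_apply)
  show ?thesis
    by (rule exI[of _ "Blinfun L"]) (auto simp: ap L nL M intro: norm_blinfun_bound)
qed

context stable_contraction
begin

text \<open>
  The circle values of an Abel mean are values of \<open>u\<close> inside the disk, and the kernel
  of a stable vector \<open>f\<close> is positive of mean
  \<open>\<parallel>f\<parallel>\<^sup>2\<close>.
\<close>

lemma von_Neumann_Abel:
  assumes u: "u \<in> Hinf" and r: "0 \<le> r" "r < 1"
  shows "norm (Abel_sum_op u T r) \<le> Hinf_norm u"
proof (rule norm_blinfun_bound)
  let ?M = "Hinf_norm u" and ?A = "Abel_sum_op u T r"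
  show M: "0 \<le> ?M" by (rule Hinf_norm_nonneg[OF u])
  have "norm (?A f) \<le> ?M * norm f" if f: "stable f" for f
  proof -
    note a = summable_abel_coeff[OF u r]
    have "2 * pi * (norm (?A f))\<^sup>2 \<le>
        (\<integral>\<theta>. (cmod (fourier_series (abel_coeff u r) \<theta>))\<^sup>2 * Re (poisson f f \<theta>) \<partial>circle_measure)"
      unfolding Abel_sum_op_eq by (rule norm_op_series_le_integral[OF a f])
    also have "\<dots> \<le> (\<integral>\<theta>. ?M\<^sup>2 * Re (poisson f f \<theta>) \<partial>circle_measure)"
      by (intro integral_mono integrable_circle_continuous continuous_intros continuous_poisson f
          continuous_fourier_series a mult_right_mono power_mono cmod_fourier_series_abel_le
          poisson_nonneg u r norm_ge_zero)
    also have "\<dots> = 2 * pi * (?M * norm f)\<^sup>2"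
      by (simp add: integral_poisson_self[OF f] power_mult_distrib)
    finally have "(norm (?A f))\<^sup>2 \<le> (?M * norm f)\<^sup>2" by simp
    then show ?thesis by (rule power2_le_imp_le) (use M in simp)
  qed
  then have "{f. stable f} \<subseteq> {f. norm (?A f) \<le> ?M * norm f}" by blast
  moreover have "closed {f. norm (?A f) \<le> ?M * norm f}"
    by (intro closed_Collect_le continuous_intros)
  ultimately have "UNIV \<subseteq> {f. norm (?A f) \<le> ?M * norm f}"
    unfolding dense_stable[symmetric] by (rule closure_minimal)
  then show "norm (?A f) \<le> ?M * norm f" for f by blast
qed

text \<open>
  For stable \<open>f\<close> the kernel is bounded on the circle, so \<open>a \<mapsto> a(T)
  f\<close> is bounded for the norm of \<open>\<ell>\<^sub>2\<close> and not only for that of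
  \<open>\<ell>\<^sub>1\<close>.
\<close>

lemma square_bound_on_stable:
  assumes f: "stable f"
  shows "\<exists>C>0. \<forall>a. summable (\<lambda>k. cmod (a k)) \<longrightarrow>
    (norm (op_series a T f))\<^sup>2 \<le> C * (\<Sum>k. (cmod (a k))\<^sup>2)"
proof -
  have "bounded (poisson f f ` {0..2*pi})"
    by (intro compact_imp_bounded compact_continuous_image continuous_poisson f) auto
  then obtain C where C: "C > 0" "\<And>\<theta>. \<theta> \<in> {0..2*pi} \<Longrightarrow> cmod (poisson f f \<theta>) \<le> C"
    unfolding bounded_pos by auto
  have "(norm (op_series a T f))\<^sup>2 \<le> C * (\<Sum>k. (cmod (a k))\<^sup>2)"
    if a: "summable (\<lambda>k. cmod (a k))" for a
  proof -
    have "2 * pi * (norm (op_series a T f))\<^sup>2 \<le>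
        (\<integral>\<theta>. (cmod (fourier_series a \<theta>))\<^sup>2 * Re (poisson f f \<theta>) \<partial>circle_measure)"
      by (rule norm_op_series_le_integral[OF a f])
    also have "\<dots> \<le> (\<integral>\<theta>. (cmod (fourier_series a \<theta>))\<^sup>2 * C \<partial>circle_measure)"
    proof (intro integral_mono integrable_circle_continuous continuous_intros continuous_poisson f
          continuous_fourier_series a mult_left_mono)
      fix \<theta> assume "\<theta> \<in> space circle_measure"
      then show "Re (poisson f f \<theta>) \<le> C"
        using C(2)[of \<theta>] complex_Re_le_cmod[of "poisson f f \<theta>"] by simp
    qed auto
    also have "\<dots> = 2 * pi * (C * (\<Sum>k. (cmod (a k))\<^sup>2))"
      using parseval_fourier_series[OF a] by (simp add: sums_iff)
    finally show ?thesis by simp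
  qed
  with C(1) show ?thesis by blast
qed

text \<open>
  On a stable vector the partial sums of the Abel means converge uniformly for \<open>r\<close> in
  the closed interval \<open>{0..1}\<close>, by the previous estimate and the square-summability of
  the Taylor coefficients; so their limit is continuous up to \<open>r = 1\<close>.
\<close>

lemma Abel_limit_on_stable:
  assumes u: "u \<in> Hinf" and f: "stable f"
  shows "\<exists>y. ((\<lambda>r. Abel_sum_op u T r f) \<longlongrightarrow> y) (at_left 1)"
proof -
  obtain C where C: "C > 0" and sq: "\<And>a. summable (\<lambda>k. cmod (a k)) \<Longrightarrow>
      (norm (op_series a T f))\<^sup>2 \<le> C * (\<Sum>k. (cmod (a k))\<^sup>2)"
    using square_bound_on_stable[OF f] by blast
  define g where "g n r = (\<Sum>k<n. cscale (abel_coeff u r k) ((blinfun_apply T ^^ k) f))" for n r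
  define \<sigma> where "\<sigma> n = (\<Sum>k<n. (cmod (taylor_coeff u k))\<^sup>2)" for n
  \<comment> \<open>The difference of two partial sums is itself a power series in \<open>T\<close>, cut off to \<open>{m..<n}\<close>.\<close>
  have diff: "(norm (g n r - g m r))\<^sup>2 \<le> C * (\<sigma> n - \<sigma> m)" if r: "r \<in> {0..1}" and mn: "m \<le> n" for n m r
  proof -
    define a where "a k = (if k \<in> {m..<n} then abel_coeff u r k else 0)" for k
    have a: "summable (\<lambda>k. cmod (a k))"
      by (rule summable_finite[of "{m..<n}"]) (auto simp: a_def)
    have "g n r - g m r = (\<Sum>k\<in>{m..<n}. cscale (abel_coeff u r k) ((blinfun_apply T ^^ k) f))"
      unfolding g_def lessThan_atLeast0 by (simp add: sum_diff_nat_ivl mn)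
    also have "\<dots> = op_series a T f"
      by (subst op_series_finite[of "{m..<n}"]) (auto simp: a_def contraction)
    finally have "(norm (g n r - g m r))\<^sup>2 \<le> C * (\<Sum>k. (cmod (a k))\<^sup>2)"
      using sq[OF a] by simp
    also have "(\<Sum>k. (cmod (a k))\<^sup>2) = (\<Sum>k\<in>{m..<n}. (cmod (abel_coeff u r k))\<^sup>2)"
      by (subst suminf_finite[of "{m..<n}"]) (auto simp: a_def)
    also have "\<dots> \<le> (\<Sum>k\<in>{m..<n}. (cmod (taylor_coeff u k))\<^sup>2)"
    proof (rule sum_mono, rule power_mono)
      fix k
      have "r ^ k \<le> 1" using r by (simp add: power_le_one)
      then show "cmod (abel_coeff u r k) \<le> cmod (taylor_coeff u k)"
        using r by (simp add: norm_mult norm_power mult_left_le_one_le)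
    qed auto
    also have "\<dots> = \<sigma> n - \<sigma> m"
      unfolding \<sigma>_def lessThan_atLeast0 by (simp add: sum_diff_nat_ivl mn)
    finally show ?thesis using C by (simp add: mult_left_mono)
  qed
  have "uniformly_Cauchy_on {0..1} g"
  proof (rule uniformly_Cauchy_onI')
    fix e :: real assume e: "0 < e"
    have "Cauchy \<sigma>"
      unfolding \<sigma>_def using summable_taylor_coeff_squares[OF u]
      by (simp add: summable_iff_convergent convergent_Cauchy)
    then obtain N where N: "\<And>m n. m \<ge> N \<Longrightarrow> n \<ge> N \<Longrightarrow> dist (\<sigma> m) (\<sigma> n) < e\<^sup>2 / C"
      using metric_CauchyD[of \<sigma> "e\<^sup>2 / C"] e C by auto
    have "dist (g m r) (g n r) < e" if "r \<in> {0..1}" "m \<ge> N" "n > m" for r m n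
    proof -
      have "(norm (g n r - g m r))\<^sup>2 \<le> C * (\<sigma> n - \<sigma> m)" using diff that by simp
      also have "\<dots> < C * (e\<^sup>2 / C)"
        using N[of n m] that C by (intro mult_strict_left_mono) (auto simp: dist_real_def)
      finally have "norm (g n r - g m r) < e"
        using C e by (intro power2_less_imp_less[of _ e]) auto
      then show ?thesis by (simp add: dist_norm norm_minus_commute)
    qed
    then show "\<exists>M. \<forall>x\<in>{0..1}. \<forall>m\<ge>M. \<forall>n>m. dist (g m x) (g n x) < e" by blast
  qed
  then obtain G where G: "uniform_limit {0..1} g G sequentially"
    using Cauchy_uniformly_convergent uniformly_convergent_on_def by blast
  have "continuous_on {0..1} G"
  proof (rule uniform_limit_theorem[OF _ G])
    show "\<forall>\<^sub>F n in sequentially. continuous_on {0..1} (g n)"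
      unfolding g_def
      by (intro always_eventually allI continuous_on_sum cscale.continuous_on continuous_intros)
  qed simp
  then have "(G \<longlongrightarrow> G 1) (at_left 1)"
    by (auto simp: continuous_on_def at_within_Icc_at_left dest!: bspec[where x = 1])
  moreover have "Abel_sum_op u T r f = G r" if "0 < r" "r < 1" for r
  proof -
    have "(\<lambda>n. g n r) \<longlonglongrightarrow> Abel_sum_op u T r f"
      using op_series_sums[OF summable_abel_coeff[OF u] contraction, of r f] that
      unfolding g_def Abel_sum_op_eq sums_def by simp
    moreover have "(\<lambda>n. g n r) \<longlonglongrightarrow> G r"
      by (rule tendsto_uniform_limitI[OF G]) (use that in auto)
    ultimately show ?thesis by (rule LIMSEQ_unique)
  qed
  then have "\<forall>\<^sub>F r in at_left 1. G r = Abel_sum_op u T r f"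
    by (intro at_left_1_eventuallyI) simp
  ultimately have "((\<lambda>r. Abel_sum_op u T r f) \<longlongrightarrow> G 1) (at_left 1)"
    by (rule Lim_transform_eventually)
  then show ?thesis by blast
qed

lemma Abel_strong_limit:
  assumes u: "u \<in> Hinf"
  shows "\<exists>L :: 'a op. norm L \<le> Hinf_norm u \<and> (\<forall>f. ((\<lambda>r. Abel_sum_op u T r f) \<longlongrightarrow> blinfun_apply L f) (at_left 1))"
proof (rule strong_limit_of_dense[OF _ _ dense_stable])
  show "\<forall>\<^sub>F r in at_left 1. norm (Abel_sum_op u T r) \<le> Hinf_norm u"
    by (intro at_left_1_eventuallyI von_Neumann_Abel u) auto
qed (use Abel_limit_on_stable[OF u] in auto)

definition calculus :: "(complex \<Rightarrow> complex) \<Rightarrow> 'a op" where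
  "calculus u = (SOME L :: 'a op. norm L \<le> Hinf_norm u \<and>
     (\<forall>f. ((\<lambda>r. Abel_sum_op u T r f) \<longlongrightarrow> blinfun_apply L f) (at_left 1)))"

lemma norm_calculus: "u \<in> Hinf \<Longrightarrow> norm (calculus u) \<le> Hinf_norm u"
  and calculus_limit: "u \<in> Hinf \<Longrightarrow> ((\<lambda>r. Abel_sum_op u T r f) \<longlongrightarrow> calculus u f) (at_left 1)"
  using someI_ex[OF Abel_strong_limit] unfolding calculus_def[symmetric] by blast+

lemma calculus_eqI:
  assumes u: "u \<in> Hinf" and ev: "\<And>r. 0 < r \<Longrightarrow> r < 1 \<Longrightarrow> Abel_sum_op u T r f = X r"
    and lim: "(X \<longlongrightarrow> y) (at_left 1)"
  shows "calculus u f = y"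
proof -
  have "((\<lambda>r. Abel_sum_op u T r f) \<longlongrightarrow> y) (at_left 1)"
    by (rule Lim_transform_eventually[OF lim]) (simp add: at_left_1_eventuallyI ev)
  from tendsto_unique[OF _ calculus_limit[OF u] this] show ?thesis by simp
qed

lemma calculus_B_ell2: "u \<in> Hinf \<Longrightarrow> calculus u \<in> B_ell2"
proof -
  assume u: "u \<in> Hinf"
  have "calculus u (cscale c f) = cscale c (calculus u f)" for c f
  proof (rule calculus_eqI[OF u])
    show "((\<lambda>r. cscale c (Abel_sum_op u T r f)) \<longlongrightarrow> cscale c (calculus u f)) (at_left 1)"
      by (intro cscale.tendsto tendsto_const calculus_limit u)
    fix r :: real assume "0 < r" "r < 1"
    then have "Abel_sum_op u T r \<in> B_ell2"
      unfolding Abel_sum_op_eq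
      by (intro op_series_B_ell2 linear_op contraction summable_abel_coeff u) auto
    then show "Abel_sum_op u T r (cscale c f) = cscale c (Abel_sum_op u T r f)"
      by (rule B_ell2_cscale)
  qed
  then show ?thesis by (simp add: B_ell2_def)
qed

lemma calculus_add:
  assumes "u \<in> Hinf" "v \<in> Hinf"
  shows "calculus (\<lambda>z. u z + v z) = calculus u + calculus v"
proof (rule blinfun_eqI, rule calculus_eqI[OF Hinf_add[OF assms]])
  fix f
  show "((\<lambda>r. Abel_sum_op u T r f + Abel_sum_op v T r f) \<longlongrightarrow> (calculus u + calculus v) f) (at_left 1)"
    unfolding blinfun.add_left by (intro tendsto_add calculus_limit assms)
  fix r :: real assume "0 < r" "r < 1"
  then show "Abel_sum_op (\<lambda>z. u z + v z) T r f = Abel_sum_op u T r f + Abel_sum_op v T r f"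
    unfolding Abel_sum_op_eq taylor_coeff_add[OF assms] distrib_left
    by (intro op_series_add summable_abel_coeff assms contraction) auto
qed

lemma calculus_cmult:
  assumes "u \<in> Hinf"
  shows "calculus (\<lambda>z. c * u z) = scalar_op c o\<^sub>L calculus u"
proof (rule blinfun_eqI, rule calculus_eqI[OF Hinf_cmult[OF assms]])
  fix f
  show "((\<lambda>r. cscale c (Abel_sum_op u T r f)) \<longlongrightarrow> (scalar_op c o\<^sub>L calculus u) f) (at_left 1)"
    by (simp add: cscale.tendsto calculus_limit assms)
  fix r :: real assume "0 < r" "r < 1"
  then show "Abel_sum_op (\<lambda>z. c * u z) T r f = cscale c (Abel_sum_op u T r f)"
    unfolding Abel_sum_op_eq taylor_coeff_cmult[OF assms] mult.left_commute[of _ c]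
    by (intro op_series_cmult summable_abel_coeff assms contraction) auto
qed

text \<open>
  Abel means are multiplicative. Products of strongly convergent nets converge strongly only because
  the left factors stay bounded, here by von Neumann's inequality.
\<close>

lemma calculus_mult:
  assumes u: "u \<in> Hinf" and v: "v \<in> Hinf"
  shows "calculus (\<lambda>z. u z * v z) = calculus u o\<^sub>L calculus v"
proof (rule blinfun_eqI, rule calculus_eqI[OF Hinf_mult[OF u v]])
  fix f
  let ?A = "\<lambda>u r. Abel_sum_op u T r"
  show "((\<lambda>r. ?A u r (?A v r f)) \<longlongrightarrow> (calculus u o\<^sub>L calculus v) f) (at_left 1)"
  proof -
    have "((\<lambda>r. ?A u r (?A v r f - calculus v f)) \<longlongrightarrow> 0) (at_left 1)"
    proof (rule Lim_null_comparison)
      show "\<forall>\<^sub>F r in at_left 1. norm (?A u r (?A v r f - calculus v f)) \<le>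
          Hinf_norm u * norm (?A v r f - calculus v f)"
      proof (rule at_left_1_eventuallyI)
        fix r :: real assume r: "0 < r" "r < 1"
        show "norm (?A u r (?A v r f - calculus v f)) \<le> Hinf_norm u * norm (?A v r f - calculus v f)"
          by (rule order_trans[OF norm_blinfun], rule mult_right_mono, rule von_Neumann_Abel[OF u])
             (use r in auto)
      qed
      have "((\<lambda>r. Hinf_norm u * norm (?A v r f - calculus v f)) \<longlongrightarrow>
          Hinf_norm u * norm (calculus v f - calculus v f)) (at_left 1)"
        by (intro tendsto_intros calculus_limit v)
      then show "((\<lambda>r. Hinf_norm u * norm (?A v r f - calculus v f)) \<longlongrightarrow> 0) (at_left 1)"
        by simp
    qed
    from tendsto_add[OF this calculus_limit[OF u, of "calculus v f"]]
    show ?thesis by (simp add: blinfun.diff_right)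
  qed
  fix r :: real assume r: "0 < r" "r < 1"
  show "?A (\<lambda>z. u z * v z) r f = ?A u r (?A v r f)"
    unfolding Abel_sum_op_eq
  proof (rule op_series_Cauchy_product[OF linear_op contraction])
    fix k
    have pw: "of_real (r ^ k) * (taylor_coeff u i * taylor_coeff v (k - i)) =
        abel_coeff u r i * abel_coeff v r (k - i)" if "i \<le> k" for i
      using that power_add[of "complex_of_real r" i "k - i"] by simp
    show "abel_coeff (\<lambda>z. u z * v z) r k = (\<Sum>i\<le>k. abel_coeff u r i * abel_coeff v r (k - i))"
      unfolding taylor_coeff_mult[OF u v] sum_distrib_left
      by (rule sum.cong[OF refl], rule pw) simp
  qed (use r in \<open>auto intro!: summable_abel_coeff[simplified] u v Hinf_mult\<close>)
qed

lemma calculus_one: "calculus (\<lambda>z. 1) = id_blinfun"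
proof (rule blinfun_eqI, rule calculus_eqI[OF Hinf_const])
  fix f and r :: real
  have "Abel_sum_op (\<lambda>z. 1) T r f =
      (\<Sum>k\<in>{0}. cscale (abel_coeff (\<lambda>z. 1) r k) ((blinfun_apply T ^^ k) f))"
    unfolding Abel_sum_op_eq
    by (rule op_series_finite) (auto simp: taylor_coeff_def contraction)
  then show "Abel_sum_op (\<lambda>z. 1) T r f = f" by (simp add: taylor_coeff_def)
  show "((\<lambda>r. f) \<longlongrightarrow> id_blinfun f) (at_left (1::real))" by simp
qed

lemma calculus_ident: "calculus (\<lambda>z. z) = T"
proof (rule blinfun_eqI, rule calculus_eqI[OF Hinf_ident])
  fix f and r :: real
  have "Abel_sum_op (\<lambda>z. z) T r f =
      (\<Sum>k\<in>{1}. cscale (abel_coeff (\<lambda>z. z) r k) ((blinfun_apply T ^^ k) f))"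
    unfolding Abel_sum_op_eq
    by (rule op_series_finite) (auto simp: taylor_coeff_def contraction)
  then show "Abel_sum_op (\<lambda>z. z) T r f = cscale (of_real r) (T f)" by (simp add: taylor_coeff_def)
  have "((\<lambda>r. cscale (of_real r) (T f)) \<longlongrightarrow> cscale (of_real 1) (T f)) (at_left 1)"
    by (intro cscale.tendsto tendsto_intros)
  then show "((\<lambda>r. cscale (of_real r) (T f)) \<longlongrightarrow> T f) (at_left 1)" by simp
qed

end

section \<open>Weak-star continuity\<close>

lemma boundary_function_bound:
  assumes u: "u \<in> Hinf" and b: "boundary_function u b"
  shows "AE \<theta> in circle_measure. cmod (b \<theta>) \<le> Hinf_norm u"
proof -
  have "AE \<theta> in circle_measure. ((\<lambda>r. u (of_real r * cis \<theta>)) \<longlongrightarrow> b \<theta>) (at_left 1)"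
    using b by (simp add: boundary_function_def)
  then show ?thesis
  proof eventually_elim
    case (elim \<theta>)
    show ?case
    proof (rule Lim_norm_ubound[OF _ elim])
      show "\<forall>\<^sub>F r in at_left 1. cmod (u (of_real r * cis \<theta>)) \<le> Hinf_norm u"
        by (intro at_left_1_eventuallyI Hinf_norm_ge[OF u]) (simp add: norm_mult)
    qed simp
  qed
qed

text \<open>
  A functional on \<open>H\<^sup>\<infinity>\<close> with a density in \<open>L\<^sup>1\<close> of
  the circle is continuous for weak-star convergent sequences by the definition of that convergence.
  The bound \<open>C\<close> on the norm of the density allows such functionals to be summed, which
  replaces a uniform boundedness argument for weak-star convergent sequences.
\<close>

definition L1_density :: "real \<Rightarrow> ((complex \<Rightarrow> complex) \<Rightarrow> complex) \<Rightarrow> bool" where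
  "L1_density C \<phi> \<longleftrightarrow> (\<exists>K. integrable circle_measure K \<and>
     (\<integral>\<theta>. cmod (K \<theta>) \<partial>circle_measure) \<le> C \<and>
     (\<forall>u\<in>Hinf. \<forall>b. boundary_function u b \<longrightarrow> \<phi> u = (\<integral>\<theta>. b \<theta> * K \<theta> \<partial>circle_measure)))"

text \<open>
  By monotone convergence the pointwise sum of the norms has finite integral, hence is finite almost
  everywhere.
\<close>

lemma AE_summable_of_summable_integral:
  fixes f :: "nat \<Rightarrow> 'a \<Rightarrow> complex"
  assumes f: "\<And>i. integrable M (f i)" and s: "summable (\<lambda>i. \<integral>x. norm (f i x) \<partial>M)"
  shows "AE x in M. summable (\<lambda>i. norm (f i x))"
proof -
  have [measurable]: "f i \<in> borel_measurable M" for i using f by (rule borel_measurable_integrable)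
  have "(\<integral>\<^sup>+ x. (\<Sum>i. ennreal (norm (f i x))) \<partial>M) = (\<Sum>i. \<integral>\<^sup>+ x. ennreal (norm (f i x)) \<partial>M)"
    by (rule nn_integral_suminf) measurable
  also have "\<dots> = (\<Sum>i. ennreal (\<integral>x. norm (f i x) \<partial>M))"
    by (intro suminf_cong nn_integral_eq_integral integrable_norm f) auto
  also have "\<dots> \<noteq> \<infinity>"
    unfolding infinity_ennreal_def by (rule ennreal_suminf_neq_top[OF s]) simp
  finally have "AE x in M. (\<Sum>i. ennreal (norm (f i x))) \<noteq> \<infinity>"
    by (intro nn_integral_PInf_AE) auto
  then show ?thesis
    unfolding infinity_ennreal_def
    by eventually_elim (rule summable_suminf_not_top, simp_all)
qed

text \<open>
  Densities whose norms are summable add up in \<open>L\<^sup>1\<close>, and boundary functions,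
  being essentially bounded, may be integrated against the sum term by term.
\<close>

lemma L1_density_suminf:
  assumes d: "\<And>i :: nat. L1_density (C i) (\<phi> i)" and C: "summable C"
    and sums: "\<And>u. u \<in> Hinf \<Longrightarrow> (\<lambda>i. \<phi> i u) sums \<psi> u"
  shows "L1_density (suminf C) \<psi>"
proof -
  have "\<forall>i. \<exists>K. integrable circle_measure K \<and>
     (\<integral>\<theta>. cmod (K \<theta>) \<partial>circle_measure) \<le> C i \<and>
     (\<forall>u\<in>Hinf. \<forall>b. boundary_function u b \<longrightarrow> \<phi> i u = (\<integral>\<theta>. b \<theta> * K \<theta> \<partial>circle_measure))"
    using d unfolding L1_density_def by simp
  from choice[OF this] obtain K where K: "integrable circle_measure (K i)"
    "(\<integral>\<theta>. cmod (K i \<theta>) \<partial>circle_measure) \<le> C i"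
    "u \<in> Hinf \<Longrightarrow> boundary_function u b \<Longrightarrow> \<phi> i u = (\<integral>\<theta>. b \<theta> * K i \<theta> \<partial>circle_measure)" for i u b
    by auto
  have s: "summable (\<lambda>i. \<integral>\<theta>. cmod (K i \<theta>) \<partial>circle_measure)"
    by (rule summable_comparison_test'[OF C]) (simp add: K)
  have ae: "AE \<theta> in circle_measure. summable (\<lambda>i. cmod (K i \<theta>))"
    by (rule AE_summable_of_summable_integral[OF K(1) s])
  define k where "k \<theta> = (\<Sum>i. K i \<theta>)" for \<theta>
  have int: "integrable circle_measure k"
    unfolding k_def by (rule integrable_suminf[OF K(1) ae s])
  have intn: "integrable circle_measure (\<lambda>\<theta>. \<Sum>i. cmod (K i \<theta>))"
    by (rule integrable_suminf) (use K(1) ae s in auto)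
  have "(\<integral>\<theta>. cmod (k \<theta>) \<partial>circle_measure) \<le> (\<integral>\<theta>. (\<Sum>i. cmod (K i \<theta>)) \<partial>circle_measure)"
  proof (rule integral_mono_AE[OF integrable_norm[OF int] intn])
    show "AE \<theta> in circle_measure. cmod (k \<theta>) \<le> (\<Sum>i. cmod (K i \<theta>))"
      using ae by eventually_elim (simp add: k_def summable_norm)
  qed
  also have "\<dots> = (\<Sum>i. \<integral>\<theta>. cmod (K i \<theta>) \<partial>circle_measure)"
    by (rule integral_suminf) (use K(1) ae s in auto)
  also have "\<dots> \<le> suminf C" by (rule suminf_le[OF K(2) s C])
  finally have bound: "(\<integral>\<theta>. cmod (k \<theta>) \<partial>circle_measure) \<le> suminf C" .
  have rep: "\<psi> u = (\<integral>\<theta>. b \<theta> * k \<theta> \<partial>circle_measure)"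
    if u: "u \<in> Hinf" and b: "boundary_function u b" for u b
  proof -
    have mb [measurable]: "b \<in> borel_measurable circle_measure"
      using b by (simp add: boundary_function_def)
    have le: "AE \<theta> in circle_measure. cmod (b \<theta> * K i \<theta>) \<le> cmod (of_real (Hinf_norm u) * K i \<theta>)" for i
      using boundary_function_bound[OF u b]
      by eventually_elim (simp add: norm_mult Hinf_norm_nonneg[OF u] mult_right_mono)
    have [measurable]: "K i \<in> borel_measurable circle_measure" for i
      using K(1) by (rule borel_measurable_integrable)
    have i: "integrable circle_measure (\<lambda>\<theta>. b \<theta> * K i \<theta>)" for i
      by (rule Bochner_Integration.integrable_bound[OF integrable_mult_right[OF K(1)] _ le]) measurable
    have "(\<lambda>i. \<integral>\<theta>. b \<theta> * K i \<theta> \<partial>circle_measure) sums (\<integral>\<theta>. (\<Sum>i. b \<theta> * K i \<theta>) \<partial>circle_measure)"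
    proof (rule sums_integral[OF i])
      show "AE \<theta> in circle_measure. summable (\<lambda>i. norm (b \<theta> * K i \<theta>))"
        using ae by eventually_elim (simp add: norm_mult summable_mult)
      show "summable (\<lambda>i. \<integral>\<theta>. norm (b \<theta> * K i \<theta>) \<partial>circle_measure)"
      proof (rule summable_comparison_test'[OF summable_mult[OF s, of "Hinf_norm u"]])
        fix n :: nat
        have "(\<integral>\<theta>. norm (b \<theta> * K n \<theta>) \<partial>circle_measure) \<le>
            (\<integral>\<theta>. cmod (of_real (Hinf_norm u) * K n \<theta>) \<partial>circle_measure)"
          by (intro integral_mono_AE le integrable_norm i integrable_mult_right K(1))
        also have "\<dots> = Hinf_norm u * (\<integral>\<theta>. cmod (K n \<theta>) \<partial>circle_measure)"
          by (simp add: norm_mult Hinf_norm_nonneg[OF u])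
        finally show "norm (\<integral>\<theta>. norm (b \<theta> * K n \<theta>) \<partial>circle_measure) \<le>
            Hinf_norm u * (\<integral>\<theta>. cmod (K n \<theta>) \<partial>circle_measure)" by simp
      qed
    qed
    also have "(\<integral>\<theta>. (\<Sum>i. b \<theta> * K i \<theta>) \<partial>circle_measure) = (\<integral>\<theta>. b \<theta> * k \<theta> \<partial>circle_measure)"
    proof (rule integral_cong_AE)
      show "AE \<theta> in circle_measure. (\<Sum>i. b \<theta> * K i \<theta>) = b \<theta> * k \<theta>"
        using ae
      proof eventually_elim
        case (elim \<theta>)
        then show ?case unfolding k_def by (rule suminf_mult[OF summable_norm_cancel])
      qed
      show "(\<lambda>\<theta>. \<Sum>i. b \<theta> * K i \<theta>) \<in> borel_measurable circle_measure" by measurable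
      show "(\<lambda>\<theta>. b \<theta> * k \<theta>) \<in> borel_measurable circle_measure"
        using int by measurable
    qed
    finally show ?thesis
      using sums_unique2[OF sums[OF u]] K(3)[OF u b] by simp
  qed
  show ?thesis unfolding L1_density_def using int bound rep by blast
qed

text \<open>
  Telescoping an approximating sequence with errors below \<open>2\<^sup>-\<^sup>n\<close>.
\<close>

lemma dense_subspace_series:
  fixes D :: "'b::real_normed_vector set"
  assumes dense: "closure D = UNIV" and diff: "\<And>f g. f \<in> D \<Longrightarrow> g \<in> D \<Longrightarrow> f - g \<in> D"
  shows "\<exists>h. (\<forall>i. h i \<in> D) \<and> summable (\<lambda>i. norm (h i)) \<and> h sums f"
proof -
  have "\<exists>g\<in>D. dist g f < (1/2) ^ n" for n :: nat
  proof -
    have "f \<in> closure D" using dense by simp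
    then show ?thesis unfolding closure_approachable by simp
  qed
  then obtain g where g: "\<And>n. g n \<in> D" "\<And>n. dist (g n) f < (1/2) ^ n" by metis
  have lim: "g \<longlonglongrightarrow> f"
  proof (rule metric_LIMSEQ_I)
    fix e :: real assume "0 < e"
    then obtain N where N: "(1/2 :: real) ^ N < e" using real_arch_pow_inv[of e "1/2"] by auto
    have "dist (g n) f < e" if "n \<ge> N" for n
    proof -
      have "(1/2 :: real) ^ n \<le> (1/2) ^ N" using that by (intro power_decreasing) auto
      then show ?thesis using g(2)[of n] N by linarith
    qed
    then show "\<exists>N. \<forall>n\<ge>N. dist (g n) f < e" by blast
  qed
  define h where "h n = (case n of 0 \<Rightarrow> g 0 | Suc m \<Rightarrow> g (Suc m) - g m)" for n
  have hD: "h n \<in> D" for n by (cases n) (auto simp: h_def g diff)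
  have psum: "(\<Sum>i<Suc n. h i) = g n" for n
    by (induction n) (auto simp: h_def)
  have "(\<lambda>n. \<Sum>i<Suc n. h i) \<longlonglongrightarrow> f" using lim by (simp only: psum)
  then have "h sums f" unfolding sums_def by (rule LIMSEQ_imp_Suc)
  moreover have "summable (\<lambda>i. norm (h i))"
  proof -
    have "summable (\<lambda>i. norm (h (Suc i)))"
    proof (rule summable_comparison_test')
      show "summable (\<lambda>n. 2 * (1/2 :: real) ^ n)" by (intro summable_mult summable_geometric) simp
      fix n :: nat
      have "norm (h (Suc n)) \<le> dist (g (Suc n)) f + dist (g n) f"
        using dist_triangle2[of "g (Suc n)" "g n" f] by (simp add: h_def dist_norm)
      also have "\<dots> \<le> (1/2) ^ Suc n + (1/2) ^ n" using g(2)[of "Suc n"] g(2)[of n] by linarith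
      also have "\<dots> \<le> 2 * (1/2) ^ n" by simp
      finally show "norm (norm (h (Suc n))) \<le> 2 * (1/2) ^ n" by simp
    qed
    then show ?thesis using summable_Suc_iff[of "\<lambda>i. norm (h i)"] by simp
  qed
  ultimately show ?thesis using hD by blast
qed

context stable_contraction
begin

text \<open>
  The density is the normalised Poisson kernel. For the Abel means this is the Fourier formula for
  \<open>a(T)\<close>; in the limit \<open>r \<rightarrow> 1\<close> dominated convergence applies,
  because \<open>u\<close> is bounded and has radial limits almost everywhere.
\<close>

lemma L1_density_stable:
  assumes f: "stable f" and g: "stable g"
  shows "L1_density (norm f * norm g) (\<lambda>u. cinner (calculus u f) g)"
  unfolding L1_density_def
proof (intro exI[of _ "\<lambda>\<theta>. poisson f g \<theta> / of_real (2 * pi)"] conjI ballI allI impI)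
  have K: "integrable circle_measure (poisson f g)"
    by (intro integrable_circle_continuous continuous_poisson f g)
  then show "integrable circle_measure (\<lambda>\<theta>. poisson f g \<theta> / of_real (2 * pi))"
    by (rule integrable_divide)
  show "(\<integral>\<theta>. cmod (poisson f g \<theta> / of_real (2 * pi)) \<partial>circle_measure) \<le> norm f * norm g"
    using integral_poisson_bound[OF f g] by (simp add: norm_divide field_simps)
  fix u b assume u: "u \<in> Hinf" and b: "boundary_function u b"
  define r where "r n = 1 - 1 / (real n + 2)" for n :: nat
  have r: "0 < r n" "r n < 1" for n by (auto simp: r_def field_simps)
  have rlim: "filterlim r (at_left 1) sequentially"
    unfolding filterlim_at
  proof (intro conjI)
    have "(\<lambda>n. 1 / (real n + 2)) \<longlonglongrightarrow> 0"
      using LIMSEQ_ignore_initial_segment[OF lim_1_over_n[where 'a = real], of 2]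
      by (simp add: add.commute)
    from tendsto_diff[OF tendsto_const[of 1] this] show "r \<longlonglongrightarrow> 1" by (simp add: r_def[abs_def])
  qed (use r in \<open>auto intro!: always_eventually simp: less_imp_neq\<close>)
  let ?F = "\<lambda>n \<theta>. fourier_series (abel_coeff u (r n)) \<theta> * poisson f g \<theta>"
  have "(\<lambda>n. \<integral>\<theta>. ?F n \<theta> \<partial>circle_measure) \<longlonglongrightarrow> (\<integral>\<theta>. b \<theta> * poisson f g \<theta> \<partial>circle_measure)"
  proof (rule integral_dominated_convergence)
    have "b \<in> borel_measurable circle_measure"
      using b by (simp add: boundary_function_def)
    then show "(\<lambda>\<theta>. b \<theta> * poisson f g \<theta>) \<in> borel_measurable circle_measure"
      using borel_measurable_integrable[OF K] by (rule borel_measurable_times)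
    show "(?F n) \<in> borel_measurable circle_measure" for n
      by (rule borel_measurable_integrable, intro integrable_circle_continuous continuous_intros
          continuous_poisson f g continuous_fourier_series summable_abel_coeff u)
         (use r[of n] in auto)
    show "integrable circle_measure (\<lambda>\<theta>. Hinf_norm u * cmod (poisson f g \<theta>))"
      by (intro integrable_mult_right integrable_norm K)
    have "AE \<theta> in circle_measure. ((\<lambda>r. u (of_real r * cis \<theta>)) \<longlongrightarrow> b \<theta>) (at_left 1)"
      using b by (simp add: boundary_function_def)
    then show "AE \<theta> in circle_measure. (\<lambda>n. ?F n \<theta>) \<longlonglongrightarrow> b \<theta> * poisson f g \<theta>"
    proof eventually_elim
      case (elim \<theta>)
      have "fourier_series (abel_coeff u (r n)) \<theta> = u (of_real (r n) * cis \<theta>)" for n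
        by (rule fourier_series_abel[OF u]) (use r[of n] in auto)
      then have "(\<lambda>n. fourier_series (abel_coeff u (r n)) \<theta>) \<longlonglongrightarrow> b \<theta>"
        using filterlim_compose[OF elim rlim] by (simp only:)
      then show ?case by (intro tendsto_mult tendsto_const)
    qed
    show "AE \<theta> in circle_measure. norm (?F n \<theta>) \<le> Hinf_norm u * cmod (poisson f g \<theta>)" for n
      unfolding norm_mult
      by (intro AE_I2 mult_right_mono cmod_fourier_series_abel_le u) (use r[of n] in auto)
  qed
  moreover have "(\<integral>\<theta>. ?F n \<theta> \<partial>circle_measure) = of_real (2 * pi) * cinner (Abel_sum_op u T (r n) f) g" for n
    unfolding Abel_sum_op_eq
    by (rule cinner_op_series[OF summable_abel_coeff[OF u] f g]) (use r[of n] in auto)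
  moreover have "(\<lambda>n. of_real (2 * pi) * cinner (Abel_sum_op u T (r n) f) g) \<longlonglongrightarrow>
      of_real (2 * pi) * cinner (calculus u f) g"
    by (intro tendsto_mult tendsto_const cinner.tendsto filterlim_compose[OF calculus_limit[OF u] rlim])
  ultimately have "(\<integral>\<theta>. b \<theta> * poisson f g \<theta> \<partial>circle_measure) = of_real (2 * pi) * cinner (calculus u f) g"
    by (simp only:) (rule LIMSEQ_unique)
  then show "cinner (calculus u f) g = (\<integral>\<theta>. b \<theta> * (poisson f g \<theta> / of_real (2 * pi)) \<partial>circle_measure)"
    by simp
qed

text \<open>
  Arbitrary vectors are norm-summable series of stable ones, so the densities for stable vectors may
  be summed, first in \<open>f\<close> and then in \<open>g\<close>. The estimate of the first step
  must keep the factor \<open>norm g\<close> for the second step to converge.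
\<close>

lemma L1_density_calculus: "\<exists>C. L1_density C (\<lambda>u. cinner (calculus u f) g)"
proof -
  have series: "\<exists>h. (\<forall>i. stable (h i)) \<and> summable (\<lambda>i. norm (h i)) \<and> h sums f" for f
    using dense_subspace_series[OF dense_stable, of f] stable_diff by simp
  have left: "\<exists>C. \<forall>g. stable g \<longrightarrow> L1_density (C * norm g) (\<lambda>u. cinner (calculus u f) g)" for f
  proof -
    obtain h where h: "\<And>i. stable (h i)" "summable (\<lambda>i. norm (h i))" "h sums f"
      using series by blast
    have "L1_density (\<Sum>i. norm (h i) * norm g) (\<lambda>u. cinner (calculus u f) g)" if g: "stable g" for g
    proof (rule L1_density_suminf)
      show "L1_density (norm (h i) * norm g) (\<lambda>u. cinner (calculus u (h i)) g)" for i
        by (rule L1_density_stable[OF h(1) g])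
      show "summable (\<lambda>i. norm (h i) * norm g)" by (intro summable_mult2 h)
      show "(\<lambda>i. cinner (calculus u (h i)) g) sums cinner (calculus u f) g" for u
        by (intro bounded_linear.sums[OF cinner.bounded_linear_left]
            bounded_linear.sums[OF blinfun.bounded_linear_right] h)
    qed
    then show ?thesis using suminf_mult2[OF h(2)] by metis
  qed
  obtain C where C: "\<And>g. stable g \<Longrightarrow> L1_density (C * norm g) (\<lambda>u. cinner (calculus u f) g)"
    using left by blast
  obtain h where h: "\<And>i. stable (h i)" "summable (\<lambda>i. norm (h i))" "h sums g"
    using series by blast
  have "L1_density (\<Sum>i. C * norm (h i)) (\<lambda>u. cinner (calculus u f) g)"
  proof (rule L1_density_suminf)
    show "L1_density (C * norm (h i)) (\<lambda>u. cinner (calculus u f) (h i))" for i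
      by (rule C[OF h(1)])
    show "summable (\<lambda>i. C * norm (h i))" by (intro summable_mult h)
    show "(\<lambda>i. cinner (calculus u f) (h i)) sums cinner (calculus u f) g" for u
      by (intro bounded_linear.sums[OF cinner.bounded_linear_right] h)
  qed
  then show ?thesis by blast
qed

lemma calculus_weak_star:
  assumes "Hinf_weak_star_lim U u"
  shows "limitin weak_operator_topology (\<lambda>k. calculus (U k)) (calculus u) sequentially"
  unfolding limitin_weak_operator_topology
proof (intro conjI allI)
  obtain B b where U: "\<And>k. U k \<in> Hinf" and u: "u \<in> Hinf"
    and B: "\<And>k. boundary_function (U k) (B k)" and b: "boundary_function u b"
    and lim: "\<And>K. integrable circle_measure K \<Longrightarrow>
      (\<lambda>k. \<integral>\<theta>. B k \<theta> * K \<theta> \<partial>circle_measure) \<longlonglongrightarrow> (\<integral>\<theta>. b \<theta> * K \<theta> \<partial>circle_measure)"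
    using assms unfolding Hinf_weak_star_lim_def by blast
  show "calculus u \<in> B_ell2" by (rule calculus_B_ell2[OF u])
  show "\<forall>\<^sub>F k in sequentially. calculus (U k) \<in> B_ell2"
    by (intro always_eventually allI calculus_B_ell2 U)
  fix f g
  obtain K where K: "integrable circle_measure K"
    "\<And>u b. u \<in> Hinf \<Longrightarrow> boundary_function u b \<Longrightarrow>
      cinner (calculus u f) g = (\<integral>\<theta>. b \<theta> * K \<theta> \<partial>circle_measure)"
    using L1_density_calculus[of f g] unfolding L1_density_def by blast
  show "(\<lambda>k. cinner (calculus (U k) f) g) \<longlonglongrightarrow> cinner (calculus u f) g"
    using lim[OF K(1)] by (simp only: K(2)[OF U B] K(2)[OF u b])
qed

theorem has_Hinf_calculus: "has_Hinf_calculus T"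
  unfolding has_Hinf_calculus_def
proof (intro exI[of _ calculus] conjI ballI allI impI)
  fix u r assume "u \<in> Hinf" "r \<in> {0<..<1::real}"
  then show "summable (\<lambda>k. scalar_op (abel_coeff u r k) o\<^sub>L op_pow T k)"
    by (intro summable_op_series summable_abel_coeff contraction) auto
next
  fix u assume "u \<in> Hinf"
  then show "limitin strong_operator_topology (Abel_sum_op u T) (calculus u) (at_left 1)"
    by (simp add: limitin_strong_operator_topology calculus_limit)
qed (simp_all add: calculus_B_ell2 calculus_add calculus_cmult calculus_mult calculus_one
      calculus_ident norm_calculus calculus_weak_star)

end

section \<open>Contractions in the non-commutative analytic Toeplitz algebra\<close>

theorem corollary1p6:
  fixes T :: "('n::finite) list op"
  assumes "T \<in> nc_toeplitz_algebra"
    and "norm T \<le> 1"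
    and "\<not> unitary_op T"
  shows "has_Hinf_calculus T"
proof -
  have B: "T \<in> B_ell2" by (rule toeplitz_commutes_right_mult(1)[OF assms(1)])
  obtain S where S: "\<And>f g. cinner (T f) g = cinner f (S g)"
    using adjoint_exists[OF B] by blast
  interpret adjoint_pair T S by unfold_locales (use B S in auto)
  \<comment> \<open>The closure of the stable vectors is a closed subspace containing the basis vectors.\<close>
  have "f \<in> closure {f. stable f}" for f
  proof (induction f rule: ell2_dense_induct)
    case closed show ?case by simp
  next
    case zero show ?case by (intro subsetD[OF closure_subset]) (simp add: stable_zero)
  next
    case (add f g)
    then obtain x y where "\<And>n. stable (x n)" "x \<longlonglongrightarrow> f" "\<And>n. stable (y n)" "y \<longlonglongrightarrow> g"
      unfolding closure_sequential by auto
    then show ?case unfolding closure_sequential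
      by (intro exI[of _ "\<lambda>n. x n + y n"]) (auto intro: stable_add tendsto_add)
  next
    case (scale c f)
    then obtain x where "\<And>n. stable (x n)" "x \<longlonglongrightarrow> f"
      unfolding closure_sequential by auto
    then show ?case unfolding closure_sequential
      by (intro exI[of _ "\<lambda>n. cscale c (x n)"])
         (auto intro: stable_cscale cscale.tendsto tendsto_const)
  next
    case (ket w)
    have "stable (ket w)"
      by (rule toeplitz_adjoint_stable_ket[OF assms adjoint_pair_axioms])
    then show ?case by (intro subsetD[OF closure_subset]) simp
  qed
  then interpret stable_contraction T S
    by unfold_locales (use assms in auto)
  show ?thesis by (rule has_Hinf_calculus)
qed

end
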